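(* There exists a family of measures $\{\nu_\alpha\}_{0<\alpha<0.2}$ on $[0,\infty)^{\mathcal E}$ such that $|\mathcal T_0|=4$ $\nu_\alpha$-almost surely.
   Context: Planar first passage percolation. $\mathbb Z^2$ is the nearest-neighbour square lattice with edge set $\mathcal E$, and $\nu_\alpha$ is a probability measure on configurations $(t_e)_{e\in\mathcal E}\in[0,\infty)^{\mathcal E}$, where $t_e$ is the passage time of the edge $e$. The length of a finite path $\pi$ is $\Gamma(\pi)=\sum_{e\in\pi}t_e$, and $T(u,v)=\inf\Gamma(\pi)$ over all paths $\pi$ connecting $u$ and $v$. A geodesic between $u$ and $v$ is a path attaining this infimum. A geodesic ray is an infinite path $\{v_0,v_1,v_2,\dots\}$ such that every finite sub-path is a geodesic between its endpoints. Two geodesic rays are considered distinct if they intersect in only finitely many edges. $\mathcal T_0$ is the set of all geodesic rays starting at the origin. The family meant in the paper is the following. Let $\mathbb N=\{1,2,3,\dots\}$ and $\Omega=\{0,1,2,3,4\}^{\mathbb N}$ with the uniform (product) measure. Let $\sigma:\Omega\to\Omega$ be the 5-adic adding machine: add one (mod 5) to the first coordinate; as long as the result is $0$, carry and add one (mod 5) to the next coordinate; all later coordinates are unchanged; $\sigma(444\dots)=000\dots$. Put $L(\omega)=\min\{i\in\mathbb N:\omega(i)>0\}$. Let $\omega_1,\omega_2$ be independent and uniform on $\Omega$. With $\mathsf e_1,\mathsf e_2$ the canonical basis vectors and $v=(x,y)$ a vertex, set $k(v,v+\mathsf e_1)=L(\sigma^{y}(\omega_1))$ and $k(v,v+\mathsf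 e_2)=L(\sigma^{x}(\omega_2))$. Let $\{X_{j,e}\}_{j\in\mathbb N,e\in\mathcal E}$ be independent, and independent of $(\omega_1,\omega_2)$, with $X_{j,e}$ uniform on $[0,\alpha^j(1-\alpha)/1000]$. Then $t_e=1+\alpha^{k(e)}+X_{k(e),e}$ (so that $1\le t_e\le 1.3$), and $\nu_\alpha$ is the law of $(t_e)_{e\in\mathcal E}$. *)

theory Defs
  imports "HOL-Probability.Probability"
begin

type_synonym vertex = "int \<times> int"
type_synonym edge = "vertex \<times> vertex"

definition \<e>1 :: vertex where "\<e>1 = (1, 0)"
definition \<e>2 :: vertex where "\<e>2 = (0, 1)"

text \<open>Every undirected edge is represented once, as a pair oriented in the positive direction.\<close>

definition lattice_edges :: "edge set" where
  "lattice_edges = range (\<lambda>v. (v, v + \<e>1)) \<union> range (\<lambda>v. (v, v + \<e>2))"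

definition adjacent :: "vertex \<Rightarrow> vertex \<Rightarrow> bool" where
  "adjacent u v \<longleftrightarrow> (u, v) \<in> lattice_edges \<or> (v, u) \<in> lattice_edges"

definition edge_between :: "vertex \<Rightarrow> vertex \<Rightarrow> edge" where
  "edge_between u v = (if (u, v) \<in> lattice_edges then (u, v) else (v, u))"

text \<open>A finite path is given by the list of its vertices; vertices may be repeated, in which
  case the length counts an edge once per traversal.\<close>

definition lattice_path :: "vertex list \<Rightarrow> bool" where
  "lattice_path p \<longleftrightarrow> p \<noteq> [] \<and> (\<forall>i. Suc i < length p \<longrightarrow> adjacent (p ! i) (p ! Suc i))"

definition path_between :: "vertex \<Rightarrow> vertex \<Rightarrow> vertex list \<Rightarrow> bool" where
  "path_between u v p \<longleftrightarrow> lattice_path p \<and> hd p = u \<and> last p = v"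

definition path_length :: "(edge \<Rightarrow> real) \<Rightarrow> vertex list \<Rightarrow> real" where
  "path_length t p = (\<Sum>i<length p - 1. t (edge_between (p ! i) (p ! Suc i)))"

definition passage_time :: "(edge \<Rightarrow> real) \<Rightarrow> vertex \<Rightarrow> vertex \<Rightarrow> real" where
  "passage_time t u v = (INF p\<in>{p. path_between u v p}. path_length t p)"

definition geodesic :: "(edge \<Rightarrow> real) \<Rightarrow> vertex \<Rightarrow> vertex \<Rightarrow> vertex list \<Rightarrow> bool" where
  "geodesic t u v p \<longleftrightarrow> path_between u v p \<and> path_length t p = passage_time t u v"

definition geodesic_ray :: "(edge \<Rightarrow> real) \<Rightarrow> (nat \<Rightarrow> vertex) \<Rightarrow> bool" where
  "geodesic_ray t \<gamma> \<longleftrightarrow> (\<forall>i j. i \<le> j \<longrightarrow> geodesic t (\<gamma> i) (\<gamma> j) (map \<gamma> [i..<Suc j]))"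

definition ray_edges :: "(nat \<Rightarrow> vertex) \<Rightarrow> edge set" where
  "ray_edges \<gamma> = range (\<lambda>n. edge_between (\<gamma> n) (\<gamma> (Suc n)))"

definition distinct_rays :: "(nat \<Rightarrow> vertex) \<Rightarrow> (nat \<Rightarrow> vertex) \<Rightarrow> bool" where
  "distinct_rays \<gamma> \<gamma>' \<longleftrightarrow> finite (ray_edges \<gamma> \<inter> ray_edges \<gamma>')"

definition origin_rays :: "(edge \<Rightarrow> real) \<Rightarrow> (nat \<Rightarrow> vertex) set" where
  "origin_rays t = {\<gamma>. geodesic_ray t \<gamma> \<and> \<gamma> 0 = (0, 0)}"

text \<open>The number of elements of a set of rays, where rays are told apart only by
  \<^const>\<open>distinct_rays\<close>: the largest size of a subset whose elements are pairwise distinct in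
  this sense. Sharing infinitely many edges is not a transitive relation in general, so this
  is not defined through a quotient.\<close>

definition num_distinct_rays :: "(nat \<Rightarrow> vertex) set \<Rightarrow> enat" where
  "num_distinct_rays R = (SUP S\<in>{S. S \<subseteq> R \<and> finite S \<and> pairwise distinct_rays S}. enat (card S))"


text \<open>Sequences are indexed by the positive integers and are \<^const>\<open>undefined\<close> at \<open>0\<close>, as
  elements of a \<^const>\<open>PiM\<close>-space.\<close>

definition digit_measure :: "(nat \<Rightarrow> nat) measure" where
  "digit_measure = PiM {1..} (\<lambda>_. uniform_count_measure {0, 1, 2, 3, 4})"

definition digit_seqs :: "(nat \<Rightarrow> nat) set" where
  "digit_seqs = {1..} \<rightarrow>\<^sub>E {0, 1, 2, 3, 4}"

text \<open>The carry reaches coordinate \<open>i\<close> iff all previous coordinates are \<open>4\<close>.\<close>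

definition adding_machine :: "(nat \<Rightarrow> nat) \<Rightarrow> nat \<Rightarrow> nat" where
  "adding_machine \<omega> =
     (\<lambda>i\<in>{1..}. if \<forall>j\<in>{1..<i}. \<omega> j = 4 then (\<omega> i + 1) mod 5 else \<omega> i)"

definition adding_machine_pow :: "int \<Rightarrow> (nat \<Rightarrow> nat) \<Rightarrow> nat \<Rightarrow> nat" where
  "adding_machine_pow n =
     (if 0 \<le> n then adding_machine ^^ nat n
      else inv_into digit_seqs adding_machine ^^ nat (- n))"

text \<open>The value at the zero sequence is a convention, relevant on a null set only; it is
  chosen in the index set of the variables \<open>X\<^sub>j\<^sub>,\<^sub>e\<close> below.\<close>

definition first_nonzero :: "(nat \<Rightarrow> nat) \<Rightarrow> nat" where
  "first_nonzero \<omega> =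
     (if \<exists>i\<ge>1. \<omega> i > 0 then LEAST i. i \<ge> 1 \<and> \<omega> i > 0 else 1)"


definition edge_level :: "(nat \<Rightarrow> nat) \<Rightarrow> (nat \<Rightarrow> nat) \<Rightarrow> edge \<Rightarrow> nat" where
  "edge_level \<omega>1 \<omega>2 = (\<lambda>(v, w).
     if w = v + \<e>1 then first_nonzero (adding_machine_pow (snd v) \<omega>1)
     else first_nonzero (adding_machine_pow (fst v) \<omega>2))"

definition nonneg_borel :: "real measure" where
  "nonneg_borel = restrict_space borel {0..}"

text \<open>The law of the family \<open>X\<^sub>j\<^sub>,\<^sub>e\<close>, \<open>j \<ge> 1\<close>: independent and uniform on intervals, where the
  one-dimensional laws are measures on the half-line.\<close>

definition perturbation_measure :: "real \<Rightarrow> (nat \<times> edge \<Rightarrow> real) measure" where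
  "perturbation_measure \<alpha> = PiM ({1..} \<times> lattice_edges)
     (\<lambda>(j, e). uniform_measure (restrict_space lborel {0..}) {0..\<alpha> ^ j * (1 - \<alpha>) / 1000})"

definition weight_config ::
  "real \<Rightarrow> (nat \<Rightarrow> nat) \<times> (nat \<Rightarrow> nat) \<times> (nat \<times> edge \<Rightarrow> real) \<Rightarrow> edge \<Rightarrow> real" where
  "weight_config \<alpha> = (\<lambda>(\<omega>1, \<omega>2, X). \<lambda>e\<in>lattice_edges.
     1 + \<alpha> ^ edge_level \<omega>1 \<omega>2 e + X (edge_level \<omega>1 \<omega>2 e, e))"

definition config_space :: "(edge \<Rightarrow> real) measure" where
  "config_space = PiM lattice_edges (\<lambda>_. nonneg_borel)"

definition fpp_measure :: "real \<Rightarrow> (edge \<Rightarrow> real) measure" where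
  "fpp_measure \<alpha> =
     distr (digit_measure \<Otimes>\<^sub>M (digit_measure \<Otimes>\<^sub>M perturbation_measure \<alpha>))
       config_space (weight_config \<alpha>)"

end

theory Submission
  imports Defs
begin

text \<open>
  The level of a column or row is the exponent \<open>k\<close> in the weights \<open>1 + \<alpha>\<^sup>k + X\<close> of its edges. Lines of
  level greater than \<open>k\<close> are spaced by \<open>5\<^sup>k\<close>. Since \<open>5 \<alpha> < 1\<close>, one can climb from the origin to the
  nearest corner \<open>c\<^sub>k\<close> of lines of level greater than \<open>k\<close> in a given quadrant at bounded total excess over the
  \<open>l\<^sup>1\<close>-distance. A geodesic cannot connect two lines of level greater than \<open>k\<close> of different directions
  by edges of lower level only, because following these two lines is cheaper. Together these facts
  bound the number of steps of a geodesic ray that do not increase the \<open>l\<^sup>1\<close>-norm, so every ray is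
  eventually monotone in some quadrant, and a monotone ray passes through \<open>c\<^sub>k\<close> for all large \<open>k\<close>.
  Almost surely, \<open>c\<^sub>k\<close> and \<open>c\<^sub>k\<^sub>+\<^sub>1\<close> are distinct points of a common line for infinitely many \<open>k\<close>, which
  forces two rays of the same quadrant to share infinitely many edges. Geodesics from the origin to
  \<open>c\<^sub>k\<close> have boundedly many backward steps and converge along a subsequence to a ray of that quadrant.
\<close>

subsection \<open>Walks\<close>

text \<open>The quantities behind the climb: both coordinates of \<open>c_k\<close> are less than
  \<open>5 ^ k\<close>, so going from one corner to the next along lines of level at least k + 1
  exceeds the l^1-distance by at most a constant times \<open>(5 * \<alpha>) ^ (k + 1)\<close>,
  which is summable. A step on a line of level k + 1 costs, perturbation included, at most
  \<open>1 + 1001 / 1000 * \<alpha> ^ (k + 1)\<close>, still less than the minimum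
  \<open>1 + \<alpha> ^ k\<close> at level k; this gap decides every comparison.

  Two obstacles shape the proof. Sharing infinitely many edges is not transitive in general, so rays
  are not counted through classes: any two rays of one quadrant must be shown to share infinitely
  many edges, and any two rays of different quadrants only finitely many. Moreover, the levels come
  from powers of the adding machine, whose negative powers are chosen preimages; they are rewritten
  as divisibility conditions on digit sums. The geometry then concerns a fixed environment, and
  randomness only supplies countably many almost sure conditions on digits and
  perturbations.\<close>

lemma adjacent_iff: "adjacent u v \<longleftrightarrow> \<bar>fst u - fst v\<bar> + \<bar>snd u - snd v\<bar> = 1"
proof -
  obtain x y x' y' where "u = (x, y)" "v = (x', y')" by (cases u, cases v) auto
  then show ?thesis
    unfolding adjacent_def lattice_edges_def \<e>1_def \<e>2_def by (auto simp: image_iff)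
qed

lemma edge_between_sym: "adjacent u v \<Longrightarrow> edge_between u v = edge_between v u"
  by (auto simp: adjacent_def edge_between_def lattice_edges_def \<e>1_def \<e>2_def)

lemma edge_between_vertical: "edge_between (x, y) (x, y + 1) = ((x, y), (x, y + 1))"
  by (auto simp: edge_between_def lattice_edges_def \<e>1_def \<e>2_def)

lemma edge_between_horizontal: "edge_between (x, y) (x + 1, y) = ((x, y), (x + 1, y))"
  by (auto simp: edge_between_def lattice_edges_def \<e>1_def \<e>2_def)

lemma adjacent_cases:
  assumes "adjacent u v"
  obtains (vertical) x y where "edge_between u v = ((x, y), (x, y + 1))"
      "fst u = x" "fst v = x" "\<bar>snd u - snd v\<bar> = 1"
    | (horizontal) x y where "edge_between u v = ((x, y), (x + 1, y))"
      "snd u = y" "snd v = y" "\<bar>fst u - fst v\<bar> = 1"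
proof -
  have "\<bar>fst u - fst v\<bar> + \<bar>snd u - snd v\<bar> = 1" using assms by (simp add: adjacent_iff)
  then consider "fst v = fst u" "snd v = snd u + 1" | "fst v = fst u" "snd u = snd v + 1"
    | "snd v = snd u" "fst v = fst u + 1" | "snd v = snd u" "fst u = fst v + 1" by linarith
  then show ?thesis
  proof cases
    case 1 then show ?thesis using vertical[of "fst u" "snd u"] edge_between_vertical[of "fst u" "snd u"]
      by (metis abs_minus_commute abs_one add_diff_cancel_left' prod.collapse)
  next
    case 2 then show ?thesis using vertical[of "fst u" "snd v"] edge_between_vertical[of "fst v" "snd v"]
      edge_between_sym[OF assms] by (metis abs_one add_diff_cancel_left' prod.collapse)
  next
    case 3 then show ?thesis using horizontal[of "fst u" "snd u"] edge_between_horizontal[of "fst u" "snd u"]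
      by (metis abs_minus_commute abs_one add_diff_cancel_left' prod.collapse)
  next
    case 4 then show ?thesis using horizontal[of "fst v" "snd v"] edge_between_horizontal[of "fst v" "snd v"]
      edge_between_sym[OF assms] by (metis abs_one add_diff_cancel_left' prod.collapse)
  qed
qed

text \<open>Walks are handled as vertex sequences on an index interval, so that cutting a walk is
  splitting a sum; \<open>path_length_map\<close> and \<open>path_as_map\<close> translate to and
  from lists.\<close>

definition cost :: "(edge \<Rightarrow> real) \<Rightarrow> (nat \<Rightarrow> vertex) \<Rightarrow> nat \<Rightarrow> nat \<Rightarrow> real" where
  "cost t \<gamma> i j = (\<Sum>l = i..<j. t (edge_between (\<gamma> l) (\<gamma> (Suc l))))"

lemma path_length_map:
  assumes "i \<le> j"
  shows "path_length t (map \<gamma> [i..<Suc j]) = cost t \<gamma> i j"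
proof -
  have "path_length t (map \<gamma> [i..<Suc j]) = (\<Sum>l<j - i. t (edge_between (\<gamma> (l + i)) (\<gamma> (Suc (l + i)))))"
    unfolding path_length_def using assms
    by (intro sum.cong) (auto simp del: upt_Suc simp: add.commute)
  also have "\<dots> = (\<Sum>l = 0 + i..<(j - i) + i. t (edge_between (\<gamma> l) (\<gamma> (Suc l))))"
    by (subst sum.shift_bounds_nat_ivl) (simp add: lessThan_atLeast0)
  finally show ?thesis using assms by (simp add: cost_def)
qed

lemma path_between_map:
  assumes "i \<le> j"
  shows "path_between u v (map \<gamma> [i..<Suc j]) \<longleftrightarrow>
    (\<forall>l. i \<le> l \<longrightarrow> l < j \<longrightarrow> adjacent (\<gamma> l) (\<gamma> (Suc l))) \<and> \<gamma> i = u \<and> \<gamma> j = v"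
proof -
  have "(\<forall>l. Suc l < length (map \<gamma> [i..<Suc j]) \<longrightarrow> adjacent (map \<gamma> [i..<Suc j] ! l) (map \<gamma> [i..<Suc j] ! Suc l))
    \<longleftrightarrow> (\<forall>l. l < j - i \<longrightarrow> adjacent (\<gamma> (i + l)) (\<gamma> (Suc (i + l))))"
    using assms by (auto simp del: upt_Suc)
  also have "\<dots> \<longleftrightarrow> (\<forall>l. i \<le> l \<longrightarrow> l < j \<longrightarrow> adjacent (\<gamma> l) (\<gamma> (Suc l)))"
    by (metis add_diff_inverse_nat diff_less_mono le_add1 less_diff_conv add.commute linorder_not_less)
  finally show ?thesis using assms
    unfolding path_between_def lattice_path_def by (auto simp del: upt_Suc simp: hd_map last_map)
qed

lemma path_as_map:
  assumes "path_between u v p"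
  obtains \<gamma> n where "p = map \<gamma> [0..<Suc n]"
proof -
  have "p = map ((!) p) [0..<length p]" by (simp add: map_nth)
  moreover have "length p = Suc (length p - 1)" using assms by (simp add: path_between_def lattice_path_def)
  ultimately show ?thesis using that by metis
qed

lemma cost_split: "i \<le> j \<Longrightarrow> j \<le> k \<Longrightarrow> cost t \<gamma> i k = cost t \<gamma> i j + cost t \<gamma> j k"
  unfolding cost_def by (simp add: sum.atLeastLessThan_concat)

text \<open>Triangle inequality for the norm with weights P and Q. They are separate because the
  comparisons below use different lower bounds for horizontal and vertical edges.\<close>

lemma cost_ge:
  fixes P Q :: real
  assumes "i \<le> j" "0 \<le> P" "0 \<le> Q"
    and "\<And>l. i \<le> l \<Longrightarrow> l < j \<Longrightarrow> P * real_of_int \<bar>fst (\<gamma> l) - fst (\<gamma> (Suc l))\<bar> + Q * real_of_int \<bar>snd (\<gamma> l) - snd (\<gamma> (Suc l))\<bar>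
      \<le> t (edge_between (\<gamma> l) (\<gamma> (Suc l)))"
  shows "P * real_of_int \<bar>fst (\<gamma> i) - fst (\<gamma> j)\<bar> + Q * real_of_int \<bar>snd (\<gamma> i) - snd (\<gamma> j)\<bar> \<le> cost t \<gamma> i j"
  using assms(1,4)
proof (induction j rule: dec_induct)
  case base
  then show ?case by (simp add: cost_def)
next
  case (step n)
  have "P * real_of_int \<bar>fst (\<gamma> i) - fst (\<gamma> (Suc n))\<bar> \<le> P * (\<bar>fst (\<gamma> i) - fst (\<gamma> n)\<bar> + \<bar>fst (\<gamma> n) - fst (\<gamma> (Suc n))\<bar>)"
    using assms(2) by (intro mult_left_mono) linarith+
  moreover have "Q * real_of_int \<bar>snd (\<gamma> i) - snd (\<gamma> (Suc n))\<bar> \<le> Q * (\<bar>snd (\<gamma> i) - snd (\<gamma> n)\<bar> + \<bar>snd (\<gamma> n) - snd (\<gamma> (Suc n))\<bar>)"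
    using assms(3) by (intro mult_left_mono) linarith+
  moreover have "P * real_of_int \<bar>fst (\<gamma> i) - fst (\<gamma> n)\<bar> + Q * real_of_int \<bar>snd (\<gamma> i) - snd (\<gamma> n)\<bar> \<le> cost t \<gamma> i n"
    using step by simp
  moreover have "P * real_of_int \<bar>fst (\<gamma> n) - fst (\<gamma> (Suc n))\<bar> + Q * real_of_int \<bar>snd (\<gamma> n) - snd (\<gamma> (Suc n))\<bar>
      \<le> t (edge_between (\<gamma> n) (\<gamma> (Suc n)))" using step by simp
  moreover have "cost t \<gamma> i (Suc n) = cost t \<gamma> i n + t (edge_between (\<gamma> n) (\<gamma> (Suc n)))"
    using step(1) by (simp add: cost_def)
  ultimately show ?case by (simp only: of_int_add distrib_left)
qed

text \<open>An upper bound for the passage time that composes along walks without reference to infima.\<close>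

inductive joined :: "(edge \<Rightarrow> real) \<Rightarrow> vertex \<Rightarrow> vertex \<Rightarrow> real \<Rightarrow> bool" for t u where
  start: "0 \<le> c \<Longrightarrow> joined t u u c"
| extend: "joined t u v c \<Longrightarrow> adjacent v w \<Longrightarrow> c + t (edge_between v w) \<le> d \<Longrightarrow> joined t u w d"

lemma joined_trans: "joined t v w d \<Longrightarrow> joined t u v c \<Longrightarrow> c + d \<le> e \<Longrightarrow> joined t u w e"
proof (induction arbitrary: e rule: joined.induct)
  case (start d)
  from start(2) show ?case
  proof cases
    case start then show ?thesis using \<open>0 \<le> d\<close> \<open>c + d \<le> e\<close> by (auto intro: joined.start)
  next
    case (extend v' c') then show ?thesis using \<open>0 \<le> d\<close> \<open>c + d \<le> e\<close>
      by (intro joined.extend[OF extend(1,2)]) linarith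
  qed
next
  case (extend v' c' w d)
  have "joined t u v' (c + c')" using extend.IH extend.prems(1) by simp
  then show ?case by (rule joined.extend) (use extend in \<open>auto simp: algebra_simps\<close>)
qed

lemma joined_mono: "joined t u v c \<Longrightarrow> c \<le> d \<Longrightarrow> joined t u v d"
  by (rule joined_trans[of t v v 0]) (auto intro: joined.start)

lemma joined_path: "joined t u v c \<Longrightarrow> \<exists>p. path_between u v p \<and> path_length t p \<le> c"
proof (induction rule: joined.induct)
  case (start c)
  then show ?case
    by (intro exI[of _ "[u]"]) (auto simp: path_between_def lattice_path_def path_length_def)
next
  case (extend v c w d)
  then obtain p where p: "path_between u v p" "path_length t p \<le> c" by blast
  obtain \<gamma> n where pm: "p = map \<gamma> [0..<Suc n]" using path_as_map[OF p(1)] .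
  define \<gamma>' where "\<gamma>' = \<gamma>(Suc n := w)"
  have pw: "p @ [w] = map \<gamma>' [0..<Suc (Suc n)]" by (simp add: pm \<gamma>'_def)
  have adj: "\<forall>l<n. adjacent (\<gamma> l) (\<gamma> (Suc l))" "\<gamma> 0 = u" "\<gamma> n = v"
    using p(1) unfolding pm by (auto simp add: path_between_map simp del: upt_Suc)
  have "path_between u w (p @ [w])" unfolding pw using adj extend(2)
    by (subst path_between_map) (auto simp: \<gamma>'_def less_Suc_eq)
  moreover have "path_length t (p @ [w]) = path_length t p + t (edge_between v w)"
    unfolding pw unfolding pm using adj by (simp add: path_length_map cost_def \<gamma>'_def del: upt_Suc)
  ultimately show ?case using p(2) extend(3) by (intro exI[of _ "p @ [w]"]) auto
qed

subsection \<open>Symmetries of the lattice\<close>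

text \<open>\<open>edge_between\<close> reorients the image, since a reflection can turn a stored
  edge into its reverse.\<close>

definition pullback :: "(vertex \<Rightarrow> vertex) \<Rightarrow> (edge \<Rightarrow> real) \<Rightarrow> edge \<Rightarrow> real" where
  "pullback \<phi> t = (\<lambda>(u, v). t (edge_between (\<phi> u) (\<phi> v)))"

text \<open>Covers the coordinate swap and the four sign changes. They reduce arguments about rows
  to columns and arguments about any quadrant to the north-east one.\<close>

locale lattice_involution =
  fixes \<phi> :: "vertex \<Rightarrow> vertex"
  assumes involution: "\<phi> (\<phi> v) = v"
    and adjacent_image: "adjacent u v \<Longrightarrow> adjacent (\<phi> u) (\<phi> v)"
begin

lemma pullback_edge_between:
  assumes "adjacent u v"
  shows "pullback \<phi> t (edge_between u v) = t (edge_between (\<phi> u) (\<phi> v))"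
  using edge_between_sym[OF adjacent_image[OF assms]]
  by (auto simp: pullback_def edge_between_def)

lemma path_between_image:
  assumes "path_between u v p"
  shows "path_between (\<phi> u) (\<phi> v) (map \<phi> p)"
  using assms by (auto simp: path_between_def lattice_path_def hd_map last_map adjacent_image)

lemma path_between_image_iff: "path_between (\<phi> u) (\<phi> v) (map \<phi> p) \<longleftrightarrow> path_between u v p"
  using path_between_image[of u v p] path_between_image[of "\<phi> u" "\<phi> v" "map \<phi> p"]
  by (auto simp: involution comp_def)

lemma path_length_image:
  assumes "path_between u v p"
  shows "path_length t (map \<phi> p) = path_length (pullback \<phi> t) p"
  using assms unfolding path_length_def path_between_def lattice_path_def
  by (intro sum.cong) (auto simp: pullback_edge_between)

lemma passage_time_image: "passage_time (pullback \<phi> t) u v = passage_time t (\<phi> u) (\<phi> v)"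
proof -
  have "path_length (pullback \<phi> t) ` {p. path_between u v p} = path_length t ` {p. path_between (\<phi> u) (\<phi> v) p}"
  proof safe
    fix p assume "path_between u v p"
    then show "path_length (pullback \<phi> t) p \<in> path_length t ` {p. path_between (\<phi> u) (\<phi> v) p}"
      by (intro image_eqI[of _ _ "map \<phi> p"]) (auto simp: path_length_image path_between_image)
  next
    fix p assume p: "path_between (\<phi> u) (\<phi> v) p"
    have "path_between u v (map \<phi> p)" using path_between_image[OF p] by (simp add: involution)
    moreover have "map \<phi> (map \<phi> p) = p" by (simp add: comp_def involution)
    ultimately show "path_length t p \<in> path_length (pullback \<phi> t) ` {p. path_between u v p}"
      by (intro image_eqI[of _ _ "map \<phi> p"]) (auto simp: path_length_image[symmetric])
  qed
  then show ?thesis by (simp add: passage_time_def)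
qed

lemma geodesic_image: "geodesic t (\<phi> u) (\<phi> v) (map \<phi> p) \<longleftrightarrow> geodesic (pullback \<phi> t) u v p"
  by (auto simp: geodesic_def path_between_image_iff path_length_image passage_time_image)

lemma geodesic_ray_image: "geodesic_ray t (\<phi> \<circ> \<gamma>) \<longleftrightarrow> geodesic_ray (pullback \<phi> t) \<gamma>"
  unfolding geodesic_ray_def by (simp add: geodesic_image[symmetric] del: upt_Suc)

lemma geodesic_ray_image': "geodesic_ray (pullback \<phi> t) (\<phi> \<circ> \<gamma>) \<longleftrightarrow> geodesic_ray t \<gamma>"
  using geodesic_ray_image[of t "\<phi> \<circ> \<gamma>"] by (simp add: comp_def involution)

end

interpretation swap: lattice_involution prod.swap
  by unfold_locales (auto simp: adjacent_iff add.commute)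

subsection \<open>Hierarchical environments\<close>

text \<open>The residue classes are nested in k, so they define a 5-adic integer \<rho> with c x
  equal to 1 plus the 5-adic valuation of x - \<rho>. As c x is a natural number for every x, \<rho>
  is not an integer.\<close>

definition five_adic_levels :: "(int \<Rightarrow> nat) \<Rightarrow> bool" where
  "five_adic_levels c \<longleftrightarrow> (\<forall>k. \<exists>r. \<forall>x. k < c x \<longleftrightarrow> 5 ^ k dvd x - r)"

lemma five_adic_levels_exists:
  assumes "five_adic_levels c"
  obtains x where "k < c x"
  using assms by (metis five_adic_levels_def diff_self dvd_0_right)

lemma finite_level_bound:
  fixes c :: "int \<Rightarrow> nat"
  obtains K where "\<And>x. \<bar>x\<bar> \<le> B \<Longrightarrow> c x \<le> K"
proof -
  have "finite (c ` {-B..B})" by simp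
  then obtain K where K: "\<forall>n\<in>c ` {-B..B}. n \<le> K" using finite_nat_set_iff_bounded_le by blast
  show ?thesis by (rule that[of K]) (use K in \<open>auto simp: abs_le_iff\<close>)
qed

text \<open>The perturbation \<open>X\<close> of an edge of level \<open>k\<close> is at most \<open>\<alpha>\<^sup>k / 1000\<close>.\<close>

definition max_cost :: "real \<Rightarrow> nat \<Rightarrow> real" where
  "max_cost \<alpha> k = 1 + 1001 / 1000 * \<alpha> ^ k"

text \<open>The fixed environment: \<open>a\<close> gives the levels of the columns and
  \<open>b\<close> those of the rows. Bounds instead of exact weights make the locale stable under
  the symmetries above.\<close>

locale hierarchy =
  fixes \<alpha> :: real and a b :: "int \<Rightarrow> nat" and t :: "edge \<Rightarrow> real"
  assumes alpha_pos: "0 < \<alpha>" and alpha_less: "\<alpha> < 1 / 5"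
    and col_levels: "five_adic_levels a"
    and row_levels: "five_adic_levels b"
    and vertical_ge: "1 + \<alpha> ^ a x \<le> t ((x, y), (x, y + 1))"
    and vertical_le: "t ((x, y), (x, y + 1)) \<le> max_cost \<alpha> (a x)"
    and horizontal_ge: "1 + \<alpha> ^ b y \<le> t ((x, y), (x + 1, y))"
    and horizontal_le: "t ((x, y), (x + 1, y)) \<le> max_cost \<alpha> (b y)"
begin

lemma power_alpha_mono: "m \<le> n \<Longrightarrow> \<alpha> ^ n \<le> \<alpha> ^ m"
  using alpha_pos alpha_less by (intro power_decreasing) auto

lemma max_cost_mono: "m \<le> n \<Longrightarrow> max_cost \<alpha> n \<le> max_cost \<alpha> m"
  using power_alpha_mono by (simp add: max_cost_def)

lemma edge_ge_1:
  assumes "adjacent u v"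
  shows "1 \<le> t (edge_between u v)"
  using assms
proof (cases rule: adjacent_cases)
  case (vertical x y)
  have "1 \<le> t ((x, y), (x, y + 1))"
    using vertical_ge[of x y] zero_less_power[OF alpha_pos, of "a x"] by linarith
  then show ?thesis by (simp only: vertical)
next
  case (horizontal x y)
  have "1 \<le> t ((x, y), (x + 1, y))"
    using horizontal_ge[of y x] zero_less_power[OF alpha_pos, of "b y"] by linarith
  then show ?thesis by (simp only: horizontal)
qed

lemma edge_ge:
  assumes "adjacent u v"
    and "fst u \<noteq> fst v \<Longrightarrow> P \<le> 1 + \<alpha> ^ b (snd u)"
    and "snd u \<noteq> snd v \<Longrightarrow> Q \<le> 1 + \<alpha> ^ a (fst u)"
  shows "P * real_of_int \<bar>fst u - fst v\<bar> + Q * real_of_int \<bar>snd u - snd v\<bar> \<le> t (edge_between u v)"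
  using assms(1)
proof (cases rule: adjacent_cases)
  case (vertical x y)
  then show ?thesis using vertical_ge[of x y] assms(3) by (simp, force)
next
  case (horizontal x y)
  then show ?thesis using horizontal_ge[of y x] assms(2) by (simp, force)
qed

lemma path_length_nonneg: "path_between u v p \<Longrightarrow> 0 \<le> path_length t p"
  unfolding path_length_def path_between_def lattice_path_def
  by (intro sum_nonneg) (metis edge_ge_1 less_diff_conv lessThan_iff order_trans zero_le_one Suc_eq_plus1)

lemma passage_time_le: "path_between u v p \<Longrightarrow> passage_time t u v \<le> path_length t p"
  unfolding passage_time_def
  by (rule cINF_lower) (auto intro!: bdd_belowI[of _ 0] path_length_nonneg)

lemma ray_adjacent: "geodesic_ray t \<gamma> \<Longrightarrow> adjacent (\<gamma> n) (\<gamma> (Suc n))"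
  unfolding geodesic_ray_def geodesic_def
  using path_between_map[of n "Suc n" "\<gamma> n" "\<gamma> (Suc n)" \<gamma>] by (simp del: upt_Suc)

lemma ray_cost_le:
  assumes "geodesic_ray t \<gamma>" "i \<le> j" "joined t (\<gamma> i) (\<gamma> j) c"
  shows "cost t \<gamma> i j \<le> c"
proof -
  obtain p where "path_between (\<gamma> i) (\<gamma> j) p" "path_length t p \<le> c"
    using joined_path assms(3) by blast
  then have "passage_time t (\<gamma> i) (\<gamma> j) \<le> c" using passage_time_le order_trans by blast
  then show ?thesis using assms(1,2) unfolding geodesic_ray_def geodesic_def
    by (metis path_length_map)
qed

lemma cost_ge_length:
  assumes "i \<le> j" "\<And>l. i \<le> l \<Longrightarrow> l < j \<Longrightarrow> adjacent (\<gamma> l) (\<gamma> (Suc l))"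
  shows "real (j - i) \<le> cost t \<gamma> i j"
proof -
  have "(\<Sum>l = i..<j. 1::real) \<le> cost t \<gamma> i j"
    unfolding cost_def by (intro sum_mono) (auto intro: edge_ge_1 assms)
  then show ?thesis by simp
qed

lemma ray_cost_ge:
  assumes "geodesic_ray t \<gamma>" "i \<le> j" "0 \<le> P" "0 \<le> Q"
    and "\<And>l. i \<le> l \<Longrightarrow> l < j \<Longrightarrow> fst (\<gamma> l) \<noteq> fst (\<gamma> (Suc l)) \<Longrightarrow> P \<le> 1 + \<alpha> ^ b (snd (\<gamma> l))"
    and "\<And>l. i \<le> l \<Longrightarrow> l < j \<Longrightarrow> snd (\<gamma> l) \<noteq> snd (\<gamma> (Suc l)) \<Longrightarrow> Q \<le> 1 + \<alpha> ^ a (fst (\<gamma> l))"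
  shows "P * real_of_int \<bar>fst (\<gamma> i) - fst (\<gamma> j)\<bar> + Q * real_of_int \<bar>snd (\<gamma> i) - snd (\<gamma> j)\<bar> \<le> cost t \<gamma> i j"
  using assms by (intro cost_ge edge_ge ray_adjacent)

lemma joined_line:
  assumes "\<And>i. i < n \<Longrightarrow> adjacent (f i) (f (Suc i)) \<and> t (edge_between (f i) (f (Suc i))) \<le> K"
  shows "joined t (f 0) (f n) (real n * K)"
  using assms
proof (induction n)
  case (Suc n)
  show ?case by (rule joined.extend[OF Suc.IH, of "f (Suc n)"]) (use Suc.prems in \<open>auto simp: algebra_simps\<close>)
qed (auto intro: joined.start)

lemma joined_vertical:
  assumes "k \<le> a x"
  shows "joined t (x, y) (x, y') (real_of_int \<bar>y - y'\<bar> * max_cost \<alpha> k)"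
proof -
  let ?K = "max_cost \<alpha> k"
  have le: "t ((x, z), (x, z + 1)) \<le> ?K" for z
    using vertical_le[of x z] max_cost_mono[OF assms] by linarith
  have up: "joined t (x, y) (x, y + int n) (real n * ?K)" for n
    using joined_line[of n "\<lambda>i. (x, y + int i)" ?K] le[of "y + int _"]
    using edge_between_vertical[of x "y + int _"] by (simp add: adjacent_iff add.commute add.left_commute)
  have "edge_between (x, y - int i) (x, y - int (Suc i)) = ((x, y - int (Suc i)), (x, y - int (Suc i) + 1))" for i
    using edge_between_vertical[of x "y - int (Suc i)"] edge_between_sym[of "(x, y - int i)" "(x, y - int (Suc i))"]
    by (simp add: adjacent_iff)
  then have down: "joined t (x, y) (x, y - int n) (real n * ?K)" for n
    using joined_line[of n "\<lambda>i. (x, y - int i)" ?K] le[of "y - int (Suc _)"] by (simp add: adjacent_iff)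
  show ?thesis
    using up[of "nat (y' - y)"] down[of "nat (y - y')"] by (cases "y \<le> y'") auto
qed

lemma joined_horizontal:
  assumes "k \<le> b y"
  shows "joined t (x, y) (x', y) (real_of_int \<bar>x - x'\<bar> * max_cost \<alpha> k)"
proof -
  let ?K = "max_cost \<alpha> k"
  have le: "t ((z, y), (z + 1, y)) \<le> ?K" for z
    using horizontal_le[of z y] max_cost_mono[OF assms] by linarith
  have up: "joined t (x, y) (x + int n, y) (real n * ?K)" for n
    using joined_line[of n "\<lambda>i. (x + int i, y)" ?K] le[of "x + int _"]
    using edge_between_horizontal[of "x + int _" y] by (simp add: adjacent_iff add.commute add.left_commute)
  have "edge_between (x - int i, y) (x - int (Suc i), y) = ((x - int (Suc i), y), (x - int (Suc i) + 1, y))" for i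
    using edge_between_horizontal[of "x - int (Suc i)" y] edge_between_sym[of "(x - int i, y)" "(x - int (Suc i), y)"]
    by (simp add: adjacent_iff)
  then have down: "joined t (x, y) (x - int n, y) (real n * ?K)" for n
    using joined_line[of n "\<lambda>i. (x - int i, y)" ?K] le[of "x - int (Suc _)"] by (simp add: adjacent_iff)
  show ?thesis
    using up[of "nat (x' - x)"] down[of "nat (x - x')"] by (cases "x \<le> x'") auto
qed

lemma hierarchy_swap: "hierarchy \<alpha> b a (pullback prod.swap t)"
  using hierarchy_axioms unfolding hierarchy_def
  by (simp add: pullback_def edge_between_vertical edge_between_horizontal)

text \<open>In a strip the vertical edges have level at most some K, while a column X of higher
  level saves \<delta> per unit of height at the fixed price of reaching it and returning. Hence the
  height of a confined ray is bounded and so is its cost, although n edges cost at least n.\<close>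

lemma ray_fst_unbounded:
  assumes ray: "geodesic_ray t \<gamma>"
  shows "\<exists>n. B < \<bar>fst (\<gamma> n)\<bar>"
proof (rule ccontr)
  assume "\<not> ?thesis"
  then have bd: "\<bar>fst (\<gamma> n)\<bar> \<le> B" for n by (simp add: not_less)
  obtain K where K: "\<And>x. \<bar>x\<bar> \<le> B \<Longrightarrow> a x \<le> K" using finite_level_bound[where c = a] by blast
  obtain X where X: "K < a X" using five_adic_levels_exists[OF col_levels] by blast
  define D where "D = real_of_int (\<bar>X\<bar> + B)"
  define \<delta> where "\<delta> = 1 + \<alpha> ^ K - max_cost \<alpha> (Suc K)"
  have \<delta>: "0 < \<delta>" using alpha_pos alpha_less zero_less_power[OF alpha_pos, of K]
    by (simp add: \<delta>_def max_cost_def)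
  have le2: "max_cost \<alpha> k \<le> 3" for k
    using max_cost_mono[of 0 k] by (simp add: max_cost_def)
  have upper: "cost t \<gamma> 0 n \<le> 6 * D + h * max_cost \<alpha> (Suc K)"
    and lower: "(1 + \<alpha> ^ K) * h \<le> cost t \<gamma> 0 n"
    if h: "h = real_of_int \<bar>snd (\<gamma> 0) - snd (\<gamma> n)\<bar>" for n h
  proof -
    obtain x0 y0 xn yn where g: "\<gamma> 0 = (x0, y0)" "\<gamma> n = (xn, yn)" by (meson surj_pair)
    have dist: "real_of_int \<bar>x - X\<bar> * max_cost \<alpha> 0 \<le> 3 * D" if "\<bar>x\<bar> \<le> B" for x
    proof -
      have "real_of_int \<bar>x - X\<bar> \<le> D" using that by (simp add: D_def)
      moreover have "z * max_cost \<alpha> 0 \<le> 3 * D" if "0 \<le> z" "z \<le> D" for z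
        using that by (simp add: max_cost_def)
      ultimately show ?thesis by simp
    qed
    \<comment> \<open>The detour has two horizontal legs of at most D edges, each costing at most 3,
      and a vertical leg in column X.\<close>
    have j1: "joined t (x0, y0) (X, y0) (3 * D)"
      by (rule joined_mono[OF joined_horizontal[of 0]]) (use dist[of x0] bd[of 0] g in auto)
    have j2: "joined t (X, y0) (X, yn) (h * max_cost \<alpha> (Suc K))"
      using joined_vertical[of "Suc K" X y0 yn] X by (simp add: h g)
    have j3: "joined t (X, yn) (xn, yn) (3 * D)"
      by (rule joined_mono[OF joined_horizontal[of 0]]) (use dist[of xn] bd[of n] g in \<open>auto simp: abs_minus_commute\<close>)
    have "joined t (\<gamma> 0) (\<gamma> n) (6 * D + h * max_cost \<alpha> (Suc K))"
      unfolding g by (rule joined_trans[OF j3 joined_trans[OF j2 j1 order_refl]]) simp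
    then show "cost t \<gamma> 0 n \<le> 6 * D + h * max_cost \<alpha> (Suc K)"
      using ray_cost_le[OF ray] by blast
    have "0 * real_of_int \<bar>fst (\<gamma> 0) - fst (\<gamma> n)\<bar> + (1 + \<alpha> ^ K) * h \<le> cost t \<gamma> 0 n"
      unfolding h using power_alpha_mono[OF K[OF bd]] alpha_pos by (intro ray_cost_ge[OF ray]) auto
    then show "(1 + \<alpha> ^ K) * h \<le> cost t \<gamma> 0 n" by simp
  qed
  have "real n \<le> 6 * D + 3 * (6 * D / \<delta>)" for n
  proof -
    define h where "h = real_of_int \<bar>snd (\<gamma> 0) - snd (\<gamma> n)\<bar>"
    have "h * \<delta> \<le> 6 * D" using upper[OF h_def] lower[OF h_def] by (simp add: \<delta>_def algebra_simps)
    then have "h \<le> 6 * D / \<delta>" using \<delta> by (simp add: pos_le_divide_eq)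
    moreover have "h * max_cost \<alpha> (Suc K) \<le> h * 3" unfolding h_def by (intro mult_left_mono le2) auto
    ultimately show ?thesis
      using upper[OF h_def] cost_ge_length[of 0 n \<gamma>] ray_adjacent[OF ray] by simp
  qed
  then show False by (meson linorder_not_le reals_Archimedean2)
qed

lemma ray_snd_unbounded:
  assumes "geodesic_ray t \<gamma>"
  shows "\<exists>n. B < \<bar>snd (\<gamma> n)\<bar>"
  using hierarchy.ray_fst_unbounded[OF hierarchy_swap, of "prod.swap \<circ> \<gamma>" B] assms
  by (simp add: swap.geodesic_ray_image')

end

section \<open>Nearest lines of high level, and walks that must meet them\<close>

text \<open>The corner \<open>c_k\<close> of the north-east quadrant has the coordinates
  \<open>nearest a k\<close> and \<open>nearest b k\<close>; the value 0 is possible.\<close>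

definition nearest :: "(int \<Rightarrow> nat) \<Rightarrow> nat \<Rightarrow> nat" where
  "nearest c k = (LEAST n. k < c (int n))"

lemma
  assumes "five_adic_levels c"
  shows nearest_level: "k < c (int (nearest c k))" and nearest_less: "int (nearest c k) < 5 ^ k"
proof -
  obtain r where r: "\<And>x. k < c x \<longleftrightarrow> 5 ^ k dvd x - r"
    using assms unfolding five_adic_levels_def by metis
  have *: "k < c (int (nat (r mod 5 ^ k)))"
    unfolding r by (simp add: mod_eq_dvd_iff[symmetric])
  then show "k < c (int (nearest c k))" unfolding nearest_def by (rule LeastI)
  have "nearest c k \<le> nat (r mod 5 ^ k)" unfolding nearest_def using * by (rule Least_le)
  moreover have "r mod 5 ^ k < 5 ^ k" "0 \<le> r mod 5 ^ k" by simp_all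
  ultimately show "int (nearest c k) < 5 ^ k" by linarith
qed

lemma nearest_least:
  assumes "0 \<le> x" "x < int (nearest c k)"
  shows "c x \<le> k"
  using assms not_less_Least[of "nat x" "\<lambda>n. k < c (int n)"]
  unfolding nearest_def by (simp add: zless_nat_eq_int_zless nat_less_iff)

lemma nearest_le: "0 \<le> x \<Longrightarrow> k < c x \<Longrightarrow> int (nearest c k) \<le> x"
  using nearest_least by (meson not_le)

lemma nearest_mono:
  assumes "five_adic_levels c" "m \<le> k"
  shows "nearest c m \<le> nearest c k"
proof -
  have "m < c (int (nearest c k))" using nearest_level[OF assms(1), of k] assms(2) by linarith
  then show ?thesis unfolding nearest_def[of c m] by (rule Least_le)
qed

lemma level_gap:
  assumes "five_adic_levels c" "k < c x" "x < z" "z < x + 5 ^ k"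
  shows "c z \<le> k"
proof (rule ccontr)
  obtain r where r: "\<And>x. k < c x \<longleftrightarrow> 5 ^ k dvd x - r"
    using assms(1) unfolding five_adic_levels_def by metis
  assume "\<not> c z \<le> k"
  then have "5 ^ k dvd (z - r) - (x - r)" using assms(2) r[of x] r[of z] by (metis dvd_diff not_le)
  then show False using assms(3,4) zdvd_imp_le[of "5 ^ k" "z - x"] by simp
qed

text \<open>Levels are finite, so a bounded window contains no line of sufficiently high
  level.\<close>

lemma nearest_unbounded:
  assumes "five_adic_levels c"
  obtains K where "\<And>k. K \<le> k \<Longrightarrow> M < int (nearest c k)"
proof -
  obtain K where K: "\<And>x. \<bar>x\<bar> \<le> M \<Longrightarrow> c x \<le> K" using finite_level_bound[where c = c] by blast
  show ?thesis
  proof (rule that[of K], rule ccontr)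
    fix k assume "K \<le> k" "\<not> M < int (nearest c k)"
    then show False using K[of "int (nearest c k)"] nearest_level[OF assms, of k] by simp
  qed
qed

text \<open>A walk with steps of size at most 1 cannot jump over the nearest line on its side, which
  lies at distance less than \<open>5 ^ k\<close>; the negative side is treated by mirroring
  c.\<close>

lemma walk_hits:
  fixes f :: "nat \<Rightarrow> int"
  assumes "five_adic_levels c" "\<And>i. \<bar>f (Suc i) - f i\<bar> \<le> 1" "f 0 = 0" "5 ^ k \<le> \<bar>f n\<bar>"
  shows "\<exists>i. k < c (f i)"
proof (cases "0 \<le> f n")
  case True
  then have "int (nearest c k) \<le> f n" using assms(4) nearest_less[OF assms(1), of k] by linarith
  then have "\<exists>i. 0 \<le> i \<and> i \<le> n \<and> f i = int (nearest c k)"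
    using assms(2,3) by (intro nat_intermed_int_val) auto
  then show ?thesis using nearest_level[OF assms(1)] by metis
next
  case False
  have c': "five_adic_levels (\<lambda>x. c (- x))"
    unfolding five_adic_levels_def
  proof
    fix k
    obtain r where r: "\<And>x. k < c x \<longleftrightarrow> 5 ^ k dvd x - r"
      using assms(1) unfolding five_adic_levels_def by metis
    have "k < c (- x) \<longleftrightarrow> 5 ^ k dvd x - (- r)" for x
      using r[of "- x"] dvd_minus_iff[of "5 ^ k" "x + r"] by simp
    then show "\<exists>r. \<forall>x. k < c (- x) \<longleftrightarrow> 5 ^ k dvd x - r" by blast
  qed
  have "int (nearest (\<lambda>x. c (- x)) k) \<le> - f n"
    using assms(4) False nearest_less[OF c', of k] by linarith
  then have "\<exists>i. 0 \<le> i \<and> i \<le> n \<and> - f i = int (nearest (\<lambda>x. c (- x)) k)"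
    using assms(2,3)
    by (intro nat_intermed_int_val) (auto simp: abs_minus_commute)
  then obtain i where "- f i = int (nearest (\<lambda>x. c (- x)) k)" by blast
  then have "k < c (- (- f i))" using nearest_level[OF c', of k] by simp
  then show ?thesis by auto
qed

text \<open>By discrete intermediate values the walk passes \<open>nearest c k\<close> on its way to
  any other such line with nonnegative coordinate, so the first line it meets is that one.\<close>

lemma walk_first_hit:
  fixes f :: "nat \<Rightarrow> int"
  assumes "five_adic_levels c" "\<And>i. \<bar>f (Suc i) - f i\<bar> \<le> 1" "f 0 \<le> int (nearest c k)" "0 \<le> f m"
    and "k < c (f m)" "\<And>l. l < m \<Longrightarrow> c (f l) \<le> k"
  shows "f m = int (nearest c k)"
proof -
  have "\<exists>i. 0 \<le> i \<and> i \<le> m \<and> f i = int (nearest c k)"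
    using assms nearest_le[of "f m" k c] by (intro nat_intermed_int_val) auto
  then obtain i where i: "i \<le> m" "f i = int (nearest c k)" by auto
  then have "i = m" using assms(6)[of i] nearest_level[OF assms(1), of k] by (cases "i < m") auto
  then show ?thesis using i by simp
qed

text \<open>The excess of the climb to a corner: the steps at level \<open>k\<close> contribute at most
  \<open>2 \<cdot> 5\<^sup>k \<cdot> 1001 / 1000 \<cdot> \<alpha>\<^sup>k\<close>.\<close>

definition slack :: "real \<Rightarrow> real" where
  "slack \<alpha> = 1001 / (500 * (1 - 5 * \<alpha>))"

definition l1_norm :: "vertex \<Rightarrow> int" where
  "l1_norm v = \<bar>fst v\<bar> + \<bar>snd v\<bar>"

definition reflect :: "int \<Rightarrow> int \<Rightarrow> vertex \<Rightarrow> vertex" where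
  "reflect r s v = (r * fst v, s * snd v)"

lemma reflect_involution:
  assumes "r \<in> {1, -1}" "s \<in> {1, -1}"
  shows "lattice_involution (reflect r s)"
  using assms by unfold_locales (auto simp: reflect_def adjacent_iff abs_minus_commute)

section \<open>The climb to the corners and the defect of a ray at a crossing\<close>

context hierarchy
begin

lemma power_alpha_pos: "0 < \<alpha> ^ k"
  using alpha_pos by simp

lemma power_alpha_nonneg: "0 \<le> \<alpha> ^ k"
  using power_alpha_pos less_imp_le by blast

lemma power_alpha_Suc: "\<alpha> ^ Suc k \<le> \<alpha> ^ k / 5"
  using alpha_less power_alpha_pos[of k] by simp

text \<open>The basic gap: \<open>1001 / 1000 * \<alpha> < 1\<close>, so one level more outweighs
  the largest perturbation.\<close>

lemma max_cost_Suc_less: "max_cost \<alpha> (Suc k) < 1 + \<alpha> ^ k"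
  using power_alpha_Suc[of k] power_alpha_pos[of k] unfolding max_cost_def by linarith

lemma ray_step:
  assumes "geodesic_ray t \<gamma>"
  shows "\<bar>fst (\<gamma> (Suc n)) - fst (\<gamma> n)\<bar> \<le> 1" "\<bar>snd (\<gamma> (Suc n)) - snd (\<gamma> n)\<bar> \<le> 1"
  using ray_adjacent[OF assms, of n] by (auto simp: adjacent_iff)

lemma hierarchy_reflect:
  assumes "r \<in> {1, -1}" "s \<in> {1, -1}"
  shows "hierarchy \<alpha> (\<lambda>x. a (r * x)) (\<lambda>y. b (s * y)) (pullback (reflect r s) t)"
proof
  show "0 < \<alpha>" "\<alpha> < 1 / 5" by (rule alpha_pos alpha_less)+
  have levels: "five_adic_levels (\<lambda>x. c (r * x))" if c: "five_adic_levels c" and r: "r \<in> {1, -1}" for c r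
    unfolding five_adic_levels_def
  proof
    fix k
    obtain r0 where r0: "\<And>x. k < c x \<longleftrightarrow> 5 ^ k dvd x - r0"
      using c unfolding five_adic_levels_def by metis
    have "k < c (r * x) \<longleftrightarrow> 5 ^ k dvd x - r * r0" for x
      using r r0[of "r * x"] dvd_minus_iff[of "5 ^ k" "x + r0"] by auto
    then show "\<exists>r0. \<forall>x. k < c (r * x) \<longleftrightarrow> 5 ^ k dvd x - r0" by blast
  qed
  show "five_adic_levels (\<lambda>x. a (r * x))" "five_adic_levels (\<lambda>y. b (s * y))"
    using levels col_levels row_levels assms by blast+
  interpret R: lattice_involution "reflect r s" using reflect_involution assms by blast
  fix x y :: int
  have e: "pullback (reflect r s) t ((x, y), (x, y + 1)) = t (edge_between (r * x, s * y) (r * x, s * y + s))"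
    "pullback (reflect r s) t ((x, y), (x + 1, y)) = t (edge_between (r * x, s * y) (r * x + r, s * y))"
    by (simp_all add: pullback_def reflect_def algebra_simps)
  \<comment> \<open>A step in negative direction is stored at its other endpoint.\<close>
  have v: "edge_between (x', y') (x', y' - 1) = ((x', y' - 1), (x', y' - 1 + 1))"
    "edge_between (x', y') (x' - 1, y') = ((x' - 1, y'), (x' - 1 + 1, y'))" for x' y'
    using edge_between_vertical[of x' "y' - 1"] edge_between_horizontal[of "x' - 1" y']
     edge_between_sym[of "(x', y')" "(x', y' - 1)"] edge_between_sym[of "(x', y')" "(x' - 1, y')"]
    by (simp_all add: adjacent_iff)
  have "s = 1 \<or> s = -1" "r = 1 \<or> r = -1" using assms by auto
  then show "1 + \<alpha> ^ a (r * x) \<le> pullback (reflect r s) t ((x, y), (x, y + 1))"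
    "pullback (reflect r s) t ((x, y), (x, y + 1)) \<le> max_cost \<alpha> (a (r * x))"
    "1 + \<alpha> ^ b (s * y) \<le> pullback (reflect r s) t ((x, y), (x + 1, y))"
    "pullback (reflect r s) t ((x, y), (x + 1, y)) \<le> max_cost \<alpha> (b (s * y))"
    unfolding e
    using vertical_ge[of "r * x" "s * y"] vertical_ge[of "r * x" "s * y - 1"]
      vertical_le[of "r * x" "s * y"] vertical_le[of "r * x" "s * y - 1"]
      horizontal_ge[of "s * y" "r * x"] horizontal_ge[of "s * y" "r * x - 1"]
      horizontal_le[of "r * x" "s * y"] horizontal_le[of "r * x - 1" "s * y"]
    by (auto simp: edge_between_vertical edge_between_horizontal v)
qed

lemma joined_col_row:
  assumes "m \<le> a x" "m \<le> b y'"
  shows "joined t (x, y) (x', y') (real_of_int (\<bar>x - x'\<bar> + \<bar>y - y'\<bar>) * max_cost \<alpha> m)"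
  \<comment> \<open>\<open>joined_trans\<close> takes the last leg first: column x is followed up to
    height y', then row y'.\<close>
  by (rule joined_trans[OF joined_horizontal joined_vertical]) (use assms in \<open>auto simp: algebra_simps\<close>)

lemma slack_pos: "0 < slack \<alpha>"
  using alpha_less by (simp add: slack_def)

text \<open>The induction carries the partial sum \<open>slack \<alpha> * (1 - q ^ k)\<close> with q
  = \<open>5 * \<alpha>\<close>. The move from \<open>c_k\<close> to the next corner has length at
  most \<open>2 * 5 ^ (k + 1)\<close> and excess at most \<open>1001 / 500 * q ^ (k + 1)\<close>.
  The increment of the partial sum is \<open>1001 / 500 * q ^ k\<close>.\<close>

lemma joined_corner:
  "joined t (0, 0) (int (nearest a k), int (nearest b k))
    (real (nearest a k) + real (nearest b k) + slack \<alpha>)"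
proof -
  let ?q = "5 * \<alpha>"
  have "joined t (0, 0) (int (nearest a k), int (nearest b k))
    (real (nearest a k) + real (nearest b k) + slack \<alpha> * (1 - ?q ^ k))" for k
  proof (induction k)
    \<comment> \<open>\<open>5 ^ 0 = 1\<close> leaves only the origin as \<open>c_0\<close>.\<close>
    case 0
    show ?case using nearest_less[OF col_levels, of 0] nearest_less[OF row_levels, of 0]
      by (auto intro: joined.start)
  next
    case (Suc k)
    let ?x = "int (nearest a k)" and ?y = "int (nearest b k)"
      and ?x' = "int (nearest a (Suc k))" and ?y' = "int (nearest b (Suc k))"
    define d where "d = real_of_int (\<bar>?x - ?x'\<bar> + \<bar>?y - ?y'\<bar>)"
    have mono: "?x \<le> ?x'" "?y \<le> ?y'"
      using nearest_mono[OF col_levels, of k "Suc k"] nearest_mono[OF row_levels, of k "Suc k"] by auto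
    \<comment> \<open>The column is that of the old corner, of level at least k + 1; the row is that
      of the new one.\<close>
    have joined: "joined t (?x, ?y) (?x', ?y') (d * max_cost \<alpha> (Suc k))"
      using nearest_level[OF col_levels, of k] nearest_level[OF row_levels, of "Suc k"]
      unfolding d_def by (intro joined_col_row) simp_all
    have "\<bar>?x - ?x'\<bar> + \<bar>?y - ?y'\<bar> \<le> 2 * 5 ^ Suc k"
      using mono nearest_less[OF col_levels, of "Suc k"] nearest_less[OF row_levels, of "Suc k"] by linarith
    then have "d \<le> real_of_int (2 * 5 ^ Suc k)" unfolding d_def by (simp only: of_int_le_iff)
    then have "d \<le> 2 * 5 ^ Suc k" by simp
    then have "d * \<alpha> ^ Suc k \<le> 2 * 5 ^ Suc k * \<alpha> ^ Suc k"
      by (intro mult_right_mono power_alpha_nonneg)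
    also have "\<dots> = 2 * ?q ^ Suc k" by (simp add: power_mult_distrib)
    finally have 1: "d * max_cost \<alpha> (Suc k) \<le> d + 1001 / 500 * ?q ^ Suc k"
      by (simp add: max_cost_def algebra_simps)
    have "?q ^ Suc k \<le> ?q ^ k" using alpha_pos alpha_less by (intro power_decreasing) auto
    moreover have "slack \<alpha> * (1 - ?q) = 1001 / 500" using alpha_less unfolding slack_def by (simp add: divide_simps)
    then have "slack \<alpha> * (1 - ?q) * ?q ^ k = 1001 / 500 * ?q ^ k" by (simp only:)
    then have "slack \<alpha> * (?q ^ k - ?q ^ Suc k) = 1001 / 500 * ?q ^ k" by (simp only: algebra_simps power_Suc)
    ultimately have 2: "1001 / 500 * ?q ^ Suc k \<le> slack \<alpha> * (1 - ?q ^ Suc k) - slack \<alpha> * (1 - ?q ^ k)"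
      unfolding right_diff_distrib mult_1_right by linarith
    have 3: "d = (real (nearest a (Suc k)) - real (nearest a k)) + (real (nearest b (Suc k)) - real (nearest b k))"
      using mono by (simp add: d_def)
    show ?case
      by (rule joined_trans[OF joined Suc.IH]) (use 1 2 3 in linarith)
  qed
  from this[of k] show ?thesis
    by (rule joined_mono) (use slack_pos alpha_pos in simp)
qed

text \<open>With d the l^1-distance of the two points, the ray pays at least
  \<open>d * (1 + \<alpha> ^ k)\<close>, whereas column then row costs at most
  \<open>d * max_cost \<alpha> (k + 1)\<close>. This leaves only d = 0.\<close>

lemma ray_corner:
  assumes ray: "geodesic_ray t \<gamma>" and "i \<le> j" "k < a (fst (\<gamma> i))" "k < b (snd (\<gamma> j))"
    and "\<And>l. i \<le> l \<Longrightarrow> l < j \<Longrightarrow> fst (\<gamma> l) \<noteq> fst (\<gamma> (Suc l)) \<Longrightarrow> b (snd (\<gamma> l)) \<le> k"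
    and "\<And>l. i \<le> l \<Longrightarrow> l < j \<Longrightarrow> snd (\<gamma> l) \<noteq> snd (\<gamma> (Suc l)) \<Longrightarrow> a (fst (\<gamma> l)) \<le> k"
  shows "\<gamma> i = \<gamma> j"
proof -
  obtain x y x' y' where g: "\<gamma> i = (x, y)" "\<gamma> j = (x', y')" by (meson surj_pair)
  let ?d = "real_of_int (\<bar>x - x'\<bar> + \<bar>y - y'\<bar>)"
  have "cost t \<gamma> i j \<le> ?d * max_cost \<alpha> (Suc k)"
    by (intro ray_cost_le[OF ray] \<open>i \<le> j\<close>) (use assms g in \<open>auto intro!: joined_col_row simp del: of_int_add\<close>)
  moreover have "(1 + \<alpha> ^ k) * real_of_int \<bar>fst (\<gamma> i) - fst (\<gamma> j)\<bar>
      + (1 + \<alpha> ^ k) * real_of_int \<bar>snd (\<gamma> i) - snd (\<gamma> j)\<bar> \<le> cost t \<gamma> i j"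
    by (intro ray_cost_ge[OF ray \<open>i \<le> j\<close>])
      (use assms power_alpha_mono in \<open>auto intro: add_nonneg_nonneg power_alpha_nonneg\<close>)
  ultimately have "?d * (1 + \<alpha> ^ k) \<le> ?d * max_cost \<alpha> (Suc k)" by (simp add: g algebra_simps)
  then have "\<not> 0 < ?d" using max_cost_Suc_less[of k] by (simp add: mult_le_cancel_left del: of_int_add)
  then show ?thesis by (auto simp: g add_pos_nonneg add_nonneg_pos)
qed

text \<open>Up to time m every horizontal edge costs at least \<open>1 + \<alpha> ^ k\<close>, so
  the ray pays an excess of at least \<open>x * \<alpha> ^ k\<close>. The competitor through
  \<open>c_k\<close> has excess at most \<open>slack \<alpha>\<close> plus about a fifth of that
  amount. Hence \<open>x * \<alpha> ^ k\<close> is controlled by the slack, and so is the cost,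
  which is at least m.\<close>

lemma short_at_first_row:
  assumes ray: "geodesic_ray t \<gamma>" and origin: "\<gamma> 0 = (0, 0)"
    and row: "k < b (snd (\<gamma> m))" and first: "\<And>l. l < m \<Longrightarrow> b (snd (\<gamma> l)) \<le> k"
    and col: "k < a (fst (\<gamma> m))" and pos: "0 \<le> fst (\<gamma> m)" "0 \<le> snd (\<gamma> m)"
  shows "real m \<le> real_of_int (l1_norm (\<gamma> m)) + 2 * slack \<alpha>"
proof -
  let ?X = "nearest a k" and ?Y = "nearest b k"
  obtain x y where g: "\<gamma> m = (x, y)" by (meson surj_pair)
  have y: "y = int ?Y"
    using walk_first_hit[of b "\<lambda>n. snd (\<gamma> n)" k m] row_levels ray_step(2)[OF ray] origin row first pos g
    by simp
  have x: "int ?X \<le> x" using nearest_le[of x k a] col pos g by simp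
  have "joined t (int ?X, int ?Y) (x, int ?Y) (real_of_int \<bar>int ?X - x\<bar> * max_cost \<alpha> (Suc k))"
    using row g y by (intro joined_horizontal) simp
  \<comment> \<open>The competitor: climb to \<open>c_k\<close>, then follow the row of the
    endpoint.\<close>
  then have "joined t (0, 0) (x, y)
    (real ?X + real ?Y + slack \<alpha> + real_of_int \<bar>int ?X - x\<bar> * max_cost \<alpha> (Suc k))"
    unfolding y by (rule joined_trans[OF _ joined_corner]) simp
  then have "cost t \<gamma> 0 m \<le> real ?X + real ?Y + slack \<alpha> + real_of_int \<bar>int ?X - x\<bar> * max_cost \<alpha> (Suc k)"
    using ray_cost_le[OF ray, of 0 m] origin g by simp
  also have "real_of_int \<bar>int ?X - x\<bar> = real_of_int x - real ?X" using x by simp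
  also have "real ?X + real ?Y + slack \<alpha> + (real_of_int x - real ?X) * max_cost \<alpha> (Suc k)
    \<le> x + real ?Y + slack \<alpha> + 1001 / 1000 * (x * \<alpha> ^ Suc k)"
  proof -
    have "0 \<le> real ?X * \<alpha> ^ Suc k" by (intro mult_nonneg_nonneg power_alpha_nonneg) simp
    then show ?thesis unfolding max_cost_def by (simp only: algebra_simps)
  qed
  also have "x * \<alpha> ^ Suc k \<le> x * (\<alpha> ^ k / 5)"
    using power_alpha_Suc[of k] pos g by (intro mult_left_mono) auto
  finally have upper: "cost t \<gamma> 0 m \<le> x + y + slack \<alpha> + 1001 / 5000 * (x * \<alpha> ^ k)" by (simp add: y)
  have "(1 + \<alpha> ^ k) * real_of_int \<bar>fst (\<gamma> 0) - fst (\<gamma> m)\<bar>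
      + 1 * real_of_int \<bar>snd (\<gamma> 0) - snd (\<gamma> m)\<bar> \<le> cost t \<gamma> 0 m"
    by (intro ray_cost_ge[OF ray])
      (use first power_alpha_mono in \<open>auto intro: add_nonneg_nonneg power_alpha_nonneg\<close>)
  then have "x + x * \<alpha> ^ k + y \<le> cost t \<gamma> 0 m" using pos g origin by (simp add: algebra_simps)
  moreover have "real m \<le> cost t \<gamma> 0 m" using cost_ge_length[of 0 m \<gamma>] ray_adjacent[OF ray] by simp
  moreover have "real_of_int (l1_norm (\<gamma> m)) = real_of_int x + real_of_int y"
    using pos g by (simp add: l1_norm_def)
  \<comment> \<open>The two bounds give
    \<open>3999 / 5000 * (x * \<alpha> ^ k) \<le> slack \<alpha>\<close>, so the remaining term
    \<open>1001 / 5000 * (x * \<alpha> ^ k)\<close> is below another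
    \<open>slack \<alpha>\<close>.\<close>
  ultimately show ?thesis using upper slack_pos unfolding of_int_add by linarith
qed

text \<open>Between its last visit to a column of level greater than \<open>k\<close> and the time \<open>m\<close> the ray uses only
  edges of level at most \<open>k\<close>, so that this part is trivial by \<open>ray_corner\<close> and the ray is at a
  crossing of two lines of level greater than \<open>k\<close> at time \<open>m\<close>.\<close>

lemma short_at_row:
  assumes ray: "geodesic_ray t \<gamma>" and origin: "\<gamma> 0 = (0, 0)"
    and row: "k < b (snd (\<gamma> m))" and first: "\<And>l. l < m \<Longrightarrow> b (snd (\<gamma> l)) \<le> k"
    and col: "l \<le> m" "k < a (fst (\<gamma> l))"
  shows "real m \<le> real_of_int (l1_norm (\<gamma> m)) + 2 * slack \<alpha>"
proof -
  define L where "L = Max {l. l \<le> m \<and> k < a (fst (\<gamma> l))}"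
  have "L \<in> {l. l \<le> m \<and> k < a (fst (\<gamma> l))}" unfolding L_def by (rule Max_in) (use col in auto)
  then have L: "L \<le> m" "k < a (fst (\<gamma> L))" by auto
  have after: "a (fst (\<gamma> i)) \<le> k" if "L < i" "i \<le> m" for i
  proof (rule ccontr)
    assume "\<not> ?thesis"
    then have "i \<le> L" unfolding L_def using that by (intro Max_ge) auto
    then show False using that by simp
  qed
  have "\<gamma> L = \<gamma> m"
  proof (rule ray_corner[OF ray L row])
    fix i assume i: "L \<le> i" "i < m" "snd (\<gamma> i) \<noteq> snd (\<gamma> (Suc i))"
    \<comment> \<open>A vertical step keeps its column, so the level can be read at time i + 1,
      which is after L even for i = L.\<close>
    then have "fst (\<gamma> i) = fst (\<gamma> (Suc i))" using ray_adjacent[OF ray, of i] by (auto simp: adjacent_iff)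
    then show "a (fst (\<gamma> i)) \<le> k" using after[of "Suc i"] i by simp
  qed (use first in auto)
  then have col': "k < a (fst (\<gamma> m))" using L by simp
  define r where "r = (if 0 \<le> fst (\<gamma> m) then 1 else - 1 :: int)"
  define s where "s = (if 0 \<le> snd (\<gamma> m) then 1 else - 1 :: int)"
  have rs: "r \<in> {1, -1}" "s \<in> {1, -1}" by (auto simp: r_def s_def)
  interpret R: lattice_involution "reflect r s" using reflect_involution rs by blast
  have eq: "r * (r * z) = z" "s * (s * z) = z" for z by (auto simp: r_def s_def)
  have "real m \<le> real_of_int (l1_norm ((reflect r s \<circ> \<gamma>) m)) + 2 * slack \<alpha>"
    by (rule hierarchy.short_at_first_row[OF hierarchy_reflect[OF rs], where k = k and \<gamma> = "reflect r s \<circ> \<gamma>"])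
      (use ray row first col' origin in \<open>simp_all add: R.geodesic_ray_image'\<close>,
       auto simp: reflect_def eq, auto simp: r_def s_def)
  then show ?thesis by (simp add: l1_norm_def reflect_def r_def s_def split: if_splits)
qed

end

subsection \<open>Rays are eventually monotone\<close>

definition eventually_northeast :: "(nat \<Rightarrow> vertex) \<Rightarrow> bool" where
  "eventually_northeast \<gamma> \<longleftrightarrow> (\<exists>N. \<forall>n\<ge>N. \<gamma> (Suc n) = \<gamma> n + \<e>1 \<or> \<gamma> (Suc n) = \<gamma> n + \<e>2)"

lemma bounded_mono_eventually_const:
  fixes f :: "nat \<Rightarrow> int"
  assumes mono: "\<And>n. f n \<le> f (Suc n)" and bound: "\<And>n. f n \<le> B"
  shows "\<exists>N. \<forall>n\<ge>N. f n = f N"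
proof -
  have mono': "f m \<le> f n" if "m \<le> n" for m n using lift_Suc_mono_le[of f m n] mono that by auto
  have "finite (range f)"
    by (rule finite_subset[of _ "{f 0..B}"]) (auto simp: mono' bound)
  then obtain N where N: "f N = Max (range f)" using Max_in[of "range f"] by (auto simp del: Max_in)
  have "f n = f N" if "N \<le> n" for n
    using mono'[OF that] Max_ge[OF \<open>finite (range f)\<close>, of "f n"] N by auto
  then show ?thesis by blast
qed

context hierarchy
begin

lemma l1_norm_step:
  assumes "geodesic_ray t \<gamma>"
  shows "\<bar>l1_norm (\<gamma> (Suc n)) - l1_norm (\<gamma> n)\<bar> \<le> 1"
  using ray_adjacent[OF assms, of n] unfolding adjacent_iff l1_norm_def by linarith

lemma l1_norm_diff:
  assumes "geodesic_ray t \<gamma>" "m \<le> n"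
  shows "\<bar>l1_norm (\<gamma> n) - l1_norm (\<gamma> m)\<bar> \<le> int (n - m)"
  using assms(2)
proof (induction n rule: dec_induct)
  case (step n)
  then show ?case using l1_norm_step[OF assms(1), of n] by (simp add: Suc_diff_le)
qed simp

text \<open>Both a row and a column of level greater than k are met. At whichever first meeting
  comes later, a line of the other direction has already been visited, as
  \<open>short_at_row\<close> requires.\<close>

lemma short_time:
  assumes ray: "geodesic_ray t \<gamma>" and origin: "\<gamma> 0 = (0, 0)"
  shows "\<exists>m. (k < b (snd (\<gamma> m)) \<or> k < a (fst (\<gamma> m)))
    \<and> real m \<le> real_of_int (l1_norm (\<gamma> m)) + 2 * slack \<alpha>"
proof -
  obtain n where "5 ^ k < \<bar>snd (\<gamma> n)\<bar>" using ray_snd_unbounded[OF ray] by blast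
  then have row: "\<exists>i. k < b (snd (\<gamma> i))"
    using walk_hits[OF row_levels, of "\<lambda>n. snd (\<gamma> n)" k n] ray_step(2)[OF ray] origin by simp
  obtain n' where "5 ^ k < \<bar>fst (\<gamma> n')\<bar>" using ray_fst_unbounded[OF ray] by blast
  then have col: "\<exists>i. k < a (fst (\<gamma> i))"
    using walk_hits[OF col_levels, of "\<lambda>n. fst (\<gamma> n)" k n'] ray_step(1)[OF ray] origin by simp
  define m where "m = (LEAST i. k < b (snd (\<gamma> i)))"
  have m: "k < b (snd (\<gamma> m))" unfolding m_def by (rule LeastI_ex[OF row])
  have m_first: "b (snd (\<gamma> l)) \<le> k" if "l < m" for l
    using not_less_Least[of l "\<lambda>i. k < b (snd (\<gamma> i))"] that unfolding m_def by (simp add: not_less)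
  define m' where "m' = (LEAST i. k < a (fst (\<gamma> i)))"
  have m': "k < a (fst (\<gamma> m'))" unfolding m'_def by (rule LeastI_ex[OF col])
  have m'_first: "a (fst (\<gamma> l)) \<le> k" if "l < m'" for l
    using not_less_Least[of l "\<lambda>i. k < a (fst (\<gamma> i))"] that unfolding m'_def by (simp add: not_less)
  show ?thesis
  proof (cases "m' \<le> m")
    case True
    then have "real m \<le> real_of_int (l1_norm (\<gamma> m)) + 2 * slack \<alpha>"
      using short_at_row[OF ray origin m m_first _ m'] by blast
    then show ?thesis using m by blast
  next
    case False
    have "real m' \<le> real_of_int (l1_norm ((prod.swap \<circ> \<gamma>) m')) + 2 * slack \<alpha>"
      by (rule hierarchy.short_at_row[OF hierarchy_swap, of "prod.swap \<circ> \<gamma>" k m' m])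
        (use ray origin m' m'_first m False in \<open>auto simp: swap.geodesic_ray_image'\<close>)
    then show ?thesis using m' by (auto simp: l1_norm_def)
  qed
qed

text \<open>The defect n minus \<open>l1_norm\<close> never decreases, so it suffices to bound it at
  some later time. A line whose level exceeds all levels within distance n is reached only after
  time n, and \<open>short_time\<close> bounds the defect there.\<close>

lemma ray_defect:
  assumes ray: "geodesic_ray t \<gamma>" and origin: "\<gamma> 0 = (0, 0)"
  shows "real n \<le> real_of_int (l1_norm (\<gamma> n)) + 2 * slack \<alpha>"
proof -
  obtain K1 where K1: "\<And>x. \<bar>x\<bar> \<le> int n \<Longrightarrow> a x \<le> K1" using finite_level_bound[where c = a] by blast
  obtain K2 where K2: "\<And>x. \<bar>x\<bar> \<le> int n \<Longrightarrow> b x \<le> K2" using finite_level_bound[where c = b] by blast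
  obtain m where m: "K1 + K2 < b (snd (\<gamma> m)) \<or> K1 + K2 < a (fst (\<gamma> m))"
    "real m \<le> real_of_int (l1_norm (\<gamma> m)) + 2 * slack \<alpha>"
    using short_time[OF ray origin] by blast
  have "int n < l1_norm (\<gamma> m)"
    using m(1) K1[of "fst (\<gamma> m)"] K2[of "snd (\<gamma> m)"] unfolding l1_norm_def by fastforce
  moreover have "l1_norm (\<gamma> m) \<le> int m" using l1_norm_diff[OF ray, of 0 m] origin by (simp add: l1_norm_def)
  ultimately have "n \<le> m" by simp
  then have "\<bar>l1_norm (\<gamma> m) - l1_norm (\<gamma> n)\<bar> \<le> int m - int n" using l1_norm_diff[OF ray, of n m] by simp
  then have "real_of_int (l1_norm (\<gamma> m) - l1_norm (\<gamma> n)) \<le> real_of_int (int m - int n)"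
    by (simp only: of_int_le_iff)
  then show ?thesis using m(2) by simp
qed

text \<open>The integer defect is monotone and bounded, hence eventually constant: every late step
  increases the l^1-norm. Then neither coordinate decreases in absolute value.\<close>

lemma ray_in_quadrant:
  assumes ray: "geodesic_ray t \<gamma>" and origin: "\<gamma> 0 = (0, 0)"
  obtains r s where "r \<in> {1, -1}" "s \<in> {1, -1}" "eventually_northeast (reflect r s \<circ> \<gamma>)"
proof -
  define f where "f n = int n - l1_norm (\<gamma> n)" for n
  have "f n \<le> f (Suc n)" for n using l1_norm_step[OF ray, of n] by (simp add: f_def)
  moreover have "f n \<le> \<lceil>2 * slack \<alpha>\<rceil>" for n
  proof -
    have "real_of_int (f n) \<le> 2 * slack \<alpha>" using ray_defect[OF ray origin, of n] by (simp add: f_def)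
    then show ?thesis by (meson le_of_int_ceiling of_int_le_iff order_trans)
  qed
  ultimately obtain N where N: "\<And>n. N \<le> n \<Longrightarrow> f n = f N"
    using bounded_mono_eventually_const by metis
  have grow: "l1_norm (\<gamma> (Suc n)) = l1_norm (\<gamma> n) + 1" if "N \<le> n" for n
    using N[of n] N[of "Suc n"] that by (simp add: f_def)
  \<comment> \<open>Once nonzero, a coordinate whose absolute value does not decrease and which
    moves by at most 1 cannot change sign.\<close>
  have sign: "\<exists>r M. r \<in> {1, -1} \<and> N \<le> M \<and> (\<forall>n\<ge>M. 0 < r * g n)"
    if g: "\<And>n. N \<le> n \<Longrightarrow> \<bar>g n\<bar> \<le> \<bar>g (Suc n)\<bar>" "\<And>n. \<bar>g (Suc n) - g n\<bar> \<le> 1" "g 0 = 0" "\<exists>n. int N < \<bar>g n\<bar>"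
    for g :: "nat \<Rightarrow> int"
  proof -
    obtain M where M: "int N < \<bar>g M\<bar>" using g(4) by blast
    have "\<bar>g n\<bar> \<le> int n" for n
    proof (induction n)
      case (Suc n) then show ?case using g(2)[of n] by simp
    qed (simp add: g(3))
    \<comment> \<open>The absolute value is at most the time, so it exceeds N only after time
      N.\<close>
    then have NM: "N \<le> M" using M by (metis le_less_trans nat_int_comparison(2) nat_less_le order.strict_trans1 linorder_not_le)
    define r where "r = sgn (g M)"
    have r: "r \<in> {1, -1}" using M by (auto simp: r_def sgn_if)
    have "0 < r * g n" if "M \<le> n" for n
      using that
    proof (induction n rule: dec_induct)
      case base show ?case using M by (auto simp: r_def sgn_if)
    next
      case (step n)
      then show ?case using g(1)[of n] g(2)[of n] NM r by auto
    qed
    then show ?thesis using r NM by blast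
  qed
  have adj: "\<bar>fst (\<gamma> n) - fst (\<gamma> (Suc n))\<bar> + \<bar>snd (\<gamma> n) - snd (\<gamma> (Suc n))\<bar> = 1" for n
    using ray_adjacent[OF ray, of n] by (simp add: adjacent_iff)
  have "\<exists>r M. r \<in> {1, -1} \<and> N \<le> M \<and> (\<forall>n\<ge>M. 0 < r * fst (\<gamma> n))"
  proof (rule sign)
    show "\<bar>fst (\<gamma> n)\<bar> \<le> \<bar>fst (\<gamma> (Suc n))\<bar>" if "N \<le> n" for n
      using grow[OF that] adj[of n] unfolding l1_norm_def by linarith
  qed (use ray_step(1)[OF ray] ray_fst_unbounded[OF ray] origin in auto)
  then obtain r M where r: "r \<in> {1, -1}" "N \<le> M" "\<And>n. M \<le> n \<Longrightarrow> 0 < r * fst (\<gamma> n)" by blast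
  have "\<exists>s M'. s \<in> {1, -1} \<and> N \<le> M' \<and> (\<forall>n\<ge>M'. 0 < s * snd (\<gamma> n))"
  proof (rule sign)
    show "\<bar>snd (\<gamma> n)\<bar> \<le> \<bar>snd (\<gamma> (Suc n))\<bar>" if "N \<le> n" for n
      using grow[OF that] adj[of n] unfolding l1_norm_def by linarith
  qed (use ray_step(2)[OF ray] ray_snd_unbounded[OF ray] origin in auto)
  then obtain s M' where s: "s \<in> {1, -1}" "N \<le> M'" "\<And>n. M' \<le> n \<Longrightarrow> 0 < s * snd (\<gamma> n)" by blast
  have "eventually_northeast (reflect r s \<circ> \<gamma>)"
    unfolding eventually_northeast_def
  proof (intro exI allI impI)
    fix n assume "max M M' \<le> n"
    then have n: "N \<le> n" "0 < r * fst (\<gamma> n)" "0 < r * fst (\<gamma> (Suc n))" "0 < s * snd (\<gamma> n)" "0 < s * snd (\<gamma> (Suc n))"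
      using r s by auto
    have "(r * fst (\<gamma> (Suc n)) = r * fst (\<gamma> n) + 1 \<and> s * snd (\<gamma> (Suc n)) = s * snd (\<gamma> n)) \<or>
       (r * fst (\<gamma> (Suc n)) = r * fst (\<gamma> n) \<and> s * snd (\<gamma> (Suc n)) = s * snd (\<gamma> n) + 1)"
      using r(1) s(1) n grow[OF n(1)] adj[of n] unfolding l1_norm_def by auto
    then show "(reflect r s \<circ> \<gamma>) (Suc n) = (reflect r s \<circ> \<gamma>) n + \<e>1 \<or> (reflect r s \<circ> \<gamma>) (Suc n) = (reflect r s \<circ> \<gamma>) n + \<e>2"
      by (auto simp: reflect_def \<e>1_def \<e>2_def)
  qed
  then show ?thesis using that r s by blast
qed

end

subsection \<open>Rays in the same quadrant\<close>

text \<open>Oriented steps rather than stored edges: a reflection acts on them coordinatewise,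
  without reorientation. Each edge carries at most two of them.\<close>

definition common_steps :: "(nat \<Rightarrow> vertex) \<Rightarrow> (nat \<Rightarrow> vertex) \<Rightarrow> (vertex \<times> vertex) set" where
  "common_steps \<gamma> \<gamma>' = range (\<lambda>n. (\<gamma> n, \<gamma> (Suc n))) \<inter> range (\<lambda>n. (\<gamma>' n, \<gamma>' (Suc n)))"

lemma finite_common_steps:
  assumes "distinct_rays \<gamma> \<gamma>'"
  shows "finite (common_steps \<gamma> \<gamma>')"
proof -
  let ?E = "ray_edges \<gamma> \<inter> ray_edges \<gamma>'"
  have "common_steps \<gamma> \<gamma>' \<subseteq> ?E \<union> prod.swap ` ?E"
  proof
    fix e assume e: "e \<in> common_steps \<gamma> \<gamma>'"
    obtain u v where uv: "e = (u, v)" by (cases e)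
    have E: "edge_between u v \<in> ?E" using e unfolding uv common_steps_def ray_edges_def by auto
    show "e \<in> ?E \<union> prod.swap ` ?E"
    proof (cases "(u, v) \<in> lattice_edges")
      case True
      then show ?thesis using E by (simp add: edge_between_def uv)
    next
      case False
      then have "(v, u) \<in> ?E" using E by (simp add: edge_between_def)
      then show ?thesis unfolding uv by force
    qed
  qed
  moreover have "finite (?E \<union> prod.swap ` ?E)" using assms by (simp add: distinct_rays_def)
  ultimately show ?thesis by (rule finite_subset)
qed

text \<open>At such \<open>k\<close> the corners \<open>c\<^sub>k\<close> and \<open>c\<^sub>k\<^sub>+\<^sub>1\<close> are distinct and lie on a common line, and the only
  monotone walk between them is a segment of this line.\<close>

definition level_switches :: "(int \<Rightarrow> nat) \<Rightarrow> (int \<Rightarrow> nat) \<Rightarrow> nat set" where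
  "level_switches a b =
    {k. (nearest a k = nearest a (Suc k)) \<noteq> (nearest b k = nearest b (Suc k))}"

locale northeast_walk =
  fixes \<gamma> :: "nat \<Rightarrow> vertex" and N :: nat
  assumes step: "N \<le> n \<Longrightarrow> \<gamma> (Suc n) = \<gamma> n + \<e>1 \<or> \<gamma> (Suc n) = \<gamma> n + \<e>2"
begin

lemma coordinates_step:
  assumes "N \<le> n"
  shows "(fst (\<gamma> (Suc n)) = fst (\<gamma> n) + 1 \<and> snd (\<gamma> (Suc n)) = snd (\<gamma> n)) \<or>
    (fst (\<gamma> (Suc n)) = fst (\<gamma> n) \<and> snd (\<gamma> (Suc n)) = snd (\<gamma> n) + 1)"
  using step[OF assms] by (auto simp: \<e>1_def \<e>2_def)

lemma coordinates_mono:
  assumes "N \<le> m" "m \<le> n"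
  shows "fst (\<gamma> m) \<le> fst (\<gamma> n)" "snd (\<gamma> m) \<le> snd (\<gamma> n)"
    "fst (\<gamma> n) + snd (\<gamma> n) = fst (\<gamma> m) + snd (\<gamma> m) + int (n - m)"
  using assms(2)
proof (induction n rule: dec_induct)
  case (step n)
  have "N \<le> n" using assms step by simp
  { case 1 then show ?case using coordinates_step[OF \<open>N \<le> n\<close>] step by linarith }
  { case 2 then show ?case using coordinates_step[OF \<open>N \<le> n\<close>] step by linarith }
  { case 3 then show ?case using coordinates_step[OF \<open>N \<le> n\<close>] step by (auto simp: Suc_diff_le) }
qed simp_all

end

context hierarchy
begin

lemma northeast_reaches:
  assumes ray: "geodesic_ray t \<gamma>" and walk: "northeast_walk \<gamma> N"
  shows "\<exists>n\<ge>N. B < fst (\<gamma> n)" "\<exists>n\<ge>N. B < snd (\<gamma> n)"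
proof -
  interpret northeast_walk \<gamma> N by (rule walk)
  have large: "\<exists>n\<ge>N. B < f n"
    if mono: "\<And>n. N \<le> n \<Longrightarrow> f N \<le> f n" and unb: "\<And>B. \<exists>n. B < \<bar>f n\<bar>" for f :: "nat \<Rightarrow> int"
  proof -
    \<comment> \<open>An absolute value above B' occurs only after N, and there
      \<open>f n \<ge> f N \<ge> - B'\<close> rules out the negative sign.\<close>
    define B' where "B' = Max ((\<lambda>n. \<bar>f n\<bar>) ` {..N}) + \<bar>B\<bar>"
    have B': "\<bar>f n\<bar> + \<bar>B\<bar> \<le> B'" if "n \<le> N" for n unfolding B'_def using that by simp
    obtain n where n: "B' < \<bar>f n\<bar>" using unb by blast
    have "N < n" using B'[of n] n by (cases "n \<le> N") auto
    moreover have "B < f n" using n mono[of n] B'[of N] \<open>N < n\<close> by auto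
    ultimately show ?thesis by (intro exI[of _ n]) auto
  qed
  show "\<exists>n\<ge>N. B < fst (\<gamma> n)" "\<exists>n\<ge>N. B < snd (\<gamma> n)"
    using large[of "\<lambda>n. fst (\<gamma> n)"] large[of "\<lambda>n. snd (\<gamma> n)"]
      coordinates_mono ray_fst_unbounded[OF ray] ray_snd_unbounded[OF ray] by simp_all
qed

text \<open>Suppose the ray meets the row of \<open>c_k\<close> before its column, and leaves that
  row below the column. From its last point on the row to its first point on the column, the
  competitor along row and then column uses only lines of level greater than k and is cheaper, a
  contradiction.\<close>

lemma northeast_through_corner_aux:
  assumes ray: "geodesic_ray t \<gamma>" and walk: "northeast_walk \<gamma> N"
    and start: "0 \<le> fst (\<gamma> N)" "fst (\<gamma> N) \<le> int (nearest a k)"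
    and ij: "N \<le> j" "j \<le> i"
    and i: "fst (\<gamma> i) = int (nearest a k)" "\<And>l. N \<le> l \<Longrightarrow> l < i \<Longrightarrow> fst (\<gamma> l) < int (nearest a k)"
    and j: "snd (\<gamma> j) = int (nearest b k)"
  shows "\<exists>n\<ge>N. \<gamma> n = (int (nearest a k), int (nearest b k))"
proof -
  interpret northeast_walk \<gamma> N by (rule walk)
  let ?X = "int (nearest a k)" and ?Y = "int (nearest b k)"
  define J where "J = Max {l. l \<le> i \<and> snd (\<gamma> l) = ?Y}"
  have "J \<in> {l. l \<le> i \<and> snd (\<gamma> l) = ?Y}" unfolding J_def by (rule Max_in) (use ij j in auto)
  then have J: "J \<le> i" "snd (\<gamma> J) = ?Y" by auto
  have "j \<le> J" unfolding J_def using ij j by (intro Max_ge) auto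
  then have NJ: "N \<le> J" using ij by simp
  have after: "?Y < snd (\<gamma> l)" if "J < l" "l \<le> i" for l
  proof -
    have "snd (\<gamma> l) \<noteq> ?Y"
    proof
      assume "snd (\<gamma> l) = ?Y"
      then have "l \<le> J" unfolding J_def using that by (intro Max_ge) auto
      then show False using that by simp
    qed
    then show ?thesis using coordinates_mono(2)[of J l] NJ J that by auto
  qed
  have "J = i"
  proof (rule ccontr)
    assume "J \<noteq> i"
    then have Ji: "J < i" using J by simp
    obtain x where x: "\<gamma> J = (x, ?Y)" using J by (cases "\<gamma> J") auto
    obtain h where h: "\<gamma> i = (?X, h)" using i by (cases "\<gamma> i") auto
    have x_bounds: "0 \<le> x" "x \<le> ?X"
      using coordinates_mono(1)[of N J] coordinates_mono(1)[of J i] NJ Ji start x h by auto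
    have h_gt: "?Y < h" using after[of i] Ji h by simp
    have col: "a (fst (\<gamma> l)) \<le> k" if "J \<le> l" "l < i" for l
      using nearest_least[of "fst (\<gamma> l)" a k] i(2)[of l] coordinates_mono(1)[of N l] start NJ that by simp
    have upper: "cost t \<gamma> J i \<le> real_of_int ((?X - x) + (h - ?Y)) * max_cost \<alpha> (Suc k)"
    proof (rule ray_cost_le[OF ray])
      have "Suc k \<le> a ?X" "Suc k \<le> b ?Y"
        using nearest_level[OF col_levels, of k] nearest_level[OF row_levels, of k] by auto
      then have "joined t (x, ?Y) (?X, h)
          (real_of_int \<bar>x - ?X\<bar> * max_cost \<alpha> (Suc k) + real_of_int \<bar>?Y - h\<bar> * max_cost \<alpha> (Suc k))"
        by (intro joined_trans[OF joined_vertical joined_horizontal order_refl])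
      then show "joined t (\<gamma> J) (\<gamma> i) (real_of_int ((?X - x) + (h - ?Y)) * max_cost \<alpha> (Suc k))"
        unfolding x h by (rule joined_mono) (use x_bounds h_gt in \<open>simp add: algebra_simps\<close>)
    qed (use Ji in simp)
    have step_J: "snd (\<gamma> (Suc J)) \<noteq> snd (\<gamma> J)" using after[of "Suc J"] Ji J by simp
    show False
    \<comment> \<open>If the next row of level greater than k is not reached, all edges of the
      segment have level at most k. Otherwise horizontal edges may be cheap, but the segment rises
      by at least \<open>5 ^ k\<close>, which exceeds its width; the vertical edges alone then
      decide.\<close>
    proof (cases "h < ?Y + 5 ^ k")
      case True
      have row: "b (snd (\<gamma> l)) \<le> k" if "J < l" "l < i" for l
        using level_gap[OF row_levels nearest_level[OF row_levels, of k], of "snd (\<gamma> l)"]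
          after[of l] coordinates_mono(2)[of l i] NJ that True h by simp
      have "(1 + \<alpha> ^ k) * real_of_int \<bar>fst (\<gamma> J) - fst (\<gamma> i)\<bar>
        + (1 + \<alpha> ^ k) * real_of_int \<bar>snd (\<gamma> J) - snd (\<gamma> i)\<bar> \<le> cost t \<gamma> J i"
      proof (rule ray_cost_ge[OF ray J(1)])
        fix l assume l: "J \<le> l" "l < i" "fst (\<gamma> l) \<noteq> fst (\<gamma> (Suc l))"
        \<comment> \<open>The step at time J is vertical, so no edge of the row itself is
          used.\<close>
        then have "l \<noteq> J" using step_J coordinates_step[OF NJ] by auto
        then show "1 + \<alpha> ^ k \<le> 1 + \<alpha> ^ b (snd (\<gamma> l))" using l row power_alpha_mono by simp
      qed (use col power_alpha_mono in \<open>auto intro: add_nonneg_nonneg power_alpha_nonneg\<close>)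
      then have "real_of_int ((?X - x) + (h - ?Y)) * (1 + \<alpha> ^ k) \<le> cost t \<gamma> J i"
        using x_bounds h_gt unfolding x h by (simp add: algebra_simps)
      then have "real_of_int ((?X - x) + (h - ?Y)) * (1 + \<alpha> ^ k)
          \<le> real_of_int ((?X - x) + (h - ?Y)) * max_cost \<alpha> (Suc k)" using upper by linarith
      moreover have "0 < real_of_int ((?X - x) + (h - ?Y))"
        unfolding of_int_0_less_iff using x_bounds h_gt by linarith
      ultimately show False using max_cost_Suc_less[of k] by (simp add: mult_le_cancel_left del: of_int_add)
    next
      case False
      have "1 * real_of_int \<bar>fst (\<gamma> J) - fst (\<gamma> i)\<bar>
        + (1 + \<alpha> ^ k) * real_of_int \<bar>snd (\<gamma> J) - snd (\<gamma> i)\<bar> \<le> cost t \<gamma> J i"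
        by (rule ray_cost_ge[OF ray J(1)])
          (use col power_alpha_mono in \<open>auto intro: add_nonneg_nonneg power_alpha_nonneg\<close>)
      define u where "u = real_of_int (?X - x)"
      define v where "v = real_of_int (h - ?Y)"
      have "\<bar>x - ?X\<bar> = ?X - x" "\<bar>?Y - h\<bar> = h - ?Y" using x_bounds h_gt by auto
      then have "u + (1 + \<alpha> ^ k) * v \<le> cost t \<gamma> J i"
        using \<open>1 * _ + _ \<le> _\<close> unfolding x h u_def v_def by simp
      also have "\<dots> \<le> (u + v) * max_cost \<alpha> (Suc k)"
        using upper unfolding u_def v_def by (simp only: of_int_add)
      also have "\<dots> = u + v + 1001 / 1000 * ((u + v) * \<alpha> ^ Suc k)" by (simp add: max_cost_def algebra_simps)
      \<comment> \<open>The excess of the competitor is at most \<open>1001 / 1000 * 2 / 5\<close>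
        times \<open>v * \<alpha> ^ k\<close>, while the ray pays all of
        \<open>v * \<alpha> ^ k\<close>.\<close>
      also have "(u + v) * \<alpha> ^ Suc k \<le> (v + v) * (\<alpha> ^ k / 5)"
      proof (rule mult_mono)
        have "?X - x \<le> h - ?Y" using False x_bounds nearest_less[OF col_levels, of k] by linarith
        then show "u + v \<le> v + v" unfolding u_def v_def by simp
      qed (use power_alpha_Suc h_gt power_alpha_nonneg[of "Suc k"] in \<open>auto simp: v_def\<close>)
      finally have "v * \<alpha> ^ k \<le> 1001 / 2500 * (v * \<alpha> ^ k)" by (simp add: algebra_simps)
      moreover have "0 < v * \<alpha> ^ k" using h_gt power_alpha_pos by (simp add: v_def)
      ultimately show False by linarith
    qed
  qed
  then show ?thesis using J i NJ by (intro exI[of _ i]) (auto simp: prod_eq_iff)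
qed

lemma northeast_through_corner:
  assumes ray: "geodesic_ray t \<gamma>" and walk: "northeast_walk \<gamma> N"
    and start: "0 \<le> fst (\<gamma> N)" "fst (\<gamma> N) \<le> int (nearest a k)"
      "0 \<le> snd (\<gamma> N)" "snd (\<gamma> N) \<le> int (nearest b k)"
  shows "\<exists>n\<ge>N. \<gamma> n = (int (nearest a k), int (nearest b k))"
proof -
  interpret northeast_walk \<gamma> N by (rule walk)
  have first: "\<exists>i\<ge>N. f i = c \<and> (\<forall>l. N \<le> l \<longrightarrow> l < i \<longrightarrow> f l < c)"
    if step: "\<And>n. N \<le> n \<Longrightarrow> f (Suc n) = f n \<or> f (Suc n) = f n + 1" and "f N \<le> c" and ge: "\<exists>n\<ge>N. c < f n"
    for f :: "nat \<Rightarrow> int" and c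
  proof -
    obtain n where n: "N \<le> n" "c < f n" using ge by blast
    have lip: "\<bar>f (Suc l) - f l\<bar> \<le> 1" if "N \<le> l" for l using step[OF that] by auto
    have "\<exists>i. N \<le> i \<and> i \<le> n \<and> f i = c"
      using lip n \<open>f N \<le> c\<close> by (intro nat_intermed_int_val) simp_all
    then have ex: "\<exists>i. N \<le> i \<and> f i = c" by blast
    define i where "i = (LEAST i. N \<le> i \<and> f i = c)"
    have i: "N \<le> i" "f i = c" using LeastI_ex[OF ex] by (auto simp: i_def)
    have "f l < c" if l: "N \<le> l" "l < i" for l
    proof (rule ccontr)
      assume "\<not> f l < c"
      then have "\<exists>i. N \<le> i \<and> i \<le> l \<and> f i = c"
        using lip l \<open>f N \<le> c\<close> by (intro nat_intermed_int_val) simp_all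
      then show False using not_less_Least[of _ "\<lambda>i. N \<le> i \<and> f i = c"] l unfolding i_def
        by (metis order.strict_trans1)
    qed
    then show ?thesis using i by blast
  qed
  have "\<exists>i\<ge>N. fst (\<gamma> i) = int (nearest a k) \<and> (\<forall>l. N \<le> l \<longrightarrow> l < i \<longrightarrow> fst (\<gamma> l) < int (nearest a k))"
    by (rule first) (use coordinates_step start northeast_reaches[OF ray walk] in auto)
  then obtain i where i: "N \<le> i" "fst (\<gamma> i) = int (nearest a k)"
    "\<And>l. N \<le> l \<Longrightarrow> l < i \<Longrightarrow> fst (\<gamma> l) < int (nearest a k)" by blast
  have "\<exists>i\<ge>N. snd (\<gamma> i) = int (nearest b k) \<and> (\<forall>l. N \<le> l \<longrightarrow> l < i \<longrightarrow> snd (\<gamma> l) < int (nearest b k))"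
    by (rule first) (use coordinates_step start northeast_reaches[OF ray walk] in auto)
  then obtain j where j: "N \<le> j" "snd (\<gamma> j) = int (nearest b k)"
    "\<And>l. N \<le> l \<Longrightarrow> l < j \<Longrightarrow> snd (\<gamma> l) < int (nearest b k)" by blast
  \<comment> \<open>The line met second plays the role of the column; the other order is obtained by
    swapping coordinates.\<close>
  show ?thesis
  proof (cases "j \<le> i")
    case True
    show ?thesis by (rule northeast_through_corner_aux[OF ray walk start(1,2) j(1) True i(2,3) j(2)])
  next
    case False
    have walk': "northeast_walk (prod.swap \<circ> \<gamma>) N"
    proof
      fix n assume "N \<le> n"
      from coordinates_step[OF this]
      show "(prod.swap \<circ> \<gamma>) (Suc n) = (prod.swap \<circ> \<gamma>) n + \<e>1 \<or>
          (prod.swap \<circ> \<gamma>) (Suc n) = (prod.swap \<circ> \<gamma>) n + \<e>2"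
        by (auto simp: prod_eq_iff \<e>1_def \<e>2_def)
    qed
    have "\<exists>n\<ge>N. (prod.swap \<circ> \<gamma>) n = (int (nearest b k), int (nearest a k))"
      by (rule hierarchy.northeast_through_corner_aux[OF hierarchy_swap _ walk', of k i j])
        (use ray start i j False in \<open>simp_all add: swap.geodesic_ray_image'\<close>)
    then show ?thesis by (auto simp: prod_eq_iff)
  qed
qed

lemma northeast_common_steps:
  assumes ray: "geodesic_ray t \<gamma>" "geodesic_ray t \<gamma>'"
    and ne: "eventually_northeast \<gamma>" "eventually_northeast \<gamma>'"
    and switches: "infinite (level_switches a b)"
  shows "infinite (common_steps \<gamma> \<gamma>')"
proof -
  let ?c = "\<lambda>k. (int (nearest a k), int (nearest b k))"
  \<comment> \<open>At a switch, equal columns mean that the next corner lies straight above, so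
    every monotone walk leaves \<open>c_k\<close> upwards; otherwise it lies straight to the
    right.\<close>
  define next_vertex where "next_vertex k =
    (if nearest a k = nearest a (Suc k) then ?c k + \<e>2 else ?c k + \<e>1)" for k
  have key: "\<exists>K. \<forall>k\<ge>K. k \<in> level_switches a b \<longrightarrow> (?c k, next_vertex k) \<in> range (\<lambda>n. (\<gamma> n, \<gamma> (Suc n)))"
    if ray: "geodesic_ray t \<gamma>" and ne: "eventually_northeast \<gamma>" for \<gamma>
  proof -
    obtain N0 where "northeast_walk \<gamma> N0"
      using ne unfolding eventually_northeast_def northeast_walk_def by blast
    then interpret N0: northeast_walk \<gamma> N0 .
    obtain n1 n2 where n: "N0 \<le> n1" "0 < fst (\<gamma> n1)" "N0 \<le> n2" "0 < snd (\<gamma> n2)"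
      using northeast_reaches[OF ray N0.northeast_walk_axioms] by blast
    define N where "N = max n1 n2"
    interpret northeast_walk \<gamma> N by unfold_locales (use N0.step n in \<open>auto simp: N_def\<close>)
    have start: "0 \<le> fst (\<gamma> N)" "0 \<le> snd (\<gamma> N)"
      using N0.coordinates_mono(1)[of n1 N] N0.coordinates_mono(2)[of n2 N] n by (auto simp: N_def)
    obtain K1 where K1: "\<And>k. K1 \<le> k \<Longrightarrow> fst (\<gamma> N) < int (nearest a k)"
      using nearest_unbounded[OF col_levels] by blast
    obtain K2 where K2: "\<And>k. K2 \<le> k \<Longrightarrow> snd (\<gamma> N) < int (nearest b k)"
      using nearest_unbounded[OF row_levels] by blast
    have "(?c k, next_vertex k) \<in> range (\<lambda>n. (\<gamma> n, \<gamma> (Suc n)))"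
      if k: "max K1 K2 \<le> k" "k \<in> level_switches a b" for k
    proof -
      have at: "\<exists>n\<ge>N. \<gamma> n = ?c k'" if "k \<le> k'" for k'
        by (rule northeast_through_corner[OF ray northeast_walk_axioms])
          (use K1[of k'] K2[of k'] k that start in auto)
      obtain n where n: "N \<le> n" "\<gamma> n = ?c k" using at[of k] by auto
      obtain n' where n': "N \<le> n'" "\<gamma> n' = ?c (Suc k)" using at[of "Suc k"] by auto
      have mono: "nearest a k \<le> nearest a (Suc k)" "nearest b k \<le> nearest b (Suc k)"
        using nearest_mono[OF col_levels, of k "Suc k"] nearest_mono[OF row_levels, of k "Suc k"] by auto
      have sw: "(nearest a k = nearest a (Suc k)) \<noteq> (nearest b k = nearest b (Suc k))"
        using k by (simp add: level_switches_def)
      have "n < n'"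
      proof (rule ccontr)
        assume "\<not> n < n'"
        then have "fst (\<gamma> n') \<le> fst (\<gamma> n)" "snd (\<gamma> n') \<le> snd (\<gamma> n)"
          using coordinates_mono[of n' n] n' by auto
        then show False using mono sw n n' by auto
      qed
      then have le: "fst (\<gamma> (Suc n)) \<le> fst (\<gamma> n')" "snd (\<gamma> (Suc n)) \<le> snd (\<gamma> n')"
        using coordinates_mono[of "Suc n" n'] n by auto
      have "\<gamma> (Suc n) = next_vertex k"
        using step[OF n(1)] le n n' sw by (auto simp: next_vertex_def \<e>1_def \<e>2_def)
      then show ?thesis using n by (intro image_eqI[of _ _ n]) auto
    qed
    then show ?thesis by blast
  qed
  obtain K where K: "\<And>k. K \<le> k \<Longrightarrow> k \<in> level_switches a b \<Longrightarrow> (?c k, next_vertex k) \<in> range (\<lambda>n. (\<gamma> n, \<gamma> (Suc n)))"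
    using key[OF ray(1) ne(1)] by blast
  obtain K' where K': "\<And>k. K' \<le> k \<Longrightarrow> k \<in> level_switches a b \<Longrightarrow> (?c k, next_vertex k) \<in> range (\<lambda>n. (\<gamma>' n, \<gamma>' (Suc n)))"
    using key[OF ray(2) ne(2)] by blast
  let ?S = "level_switches a b \<inter> {max K K'..}"
  have "infinite ?S"
    using switches by (metis Diff_Compl Diff_infinite_finite Compl_atLeast finite_lessThan)
  \<comment> \<open>At a switch one coordinate of the corner strictly grows, and neither ever
    decreases, so \<open>c_k\<close> does not recur.\<close>
  moreover have "inj_on (\<lambda>k. (?c k, next_vertex k)) ?S"
  proof (rule linorder_inj_onI)
    fix k k' assume k: "k < k'" "k \<in> ?S"
    have "nearest a k \<le> nearest a (Suc k)" "nearest b k \<le> nearest b (Suc k)"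
      "nearest a (Suc k) \<le> nearest a k'" "nearest b (Suc k) \<le> nearest b k'"
      using nearest_mono[OF col_levels] nearest_mono[OF row_levels] k by auto
    then show "(?c k, next_vertex k) \<noteq> (?c k', next_vertex k')"
      using k(2) unfolding level_switches_def by auto
  qed auto
  ultimately have "infinite ((\<lambda>k. (?c k, next_vertex k)) ` ?S)" by (simp add: finite_image_iff)
  moreover have "(\<lambda>k. (?c k, next_vertex k)) ` ?S \<subseteq> common_steps \<gamma> \<gamma>'"
    unfolding common_steps_def using K K' by auto
  ultimately show ?thesis using finite_subset by blast
qed

end

subsection \<open>Existence and number of rays\<close>

text \<open>Compactness by nested pigeonholes: infinite index sets S i decrease with i, and on S i
  the value at position i is constant.\<close>

lemma constant_on_prefixes:
  fixes G :: "nat \<Rightarrow> nat \<Rightarrow> 'a"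
  assumes "\<And>i. finite (range (\<lambda>k. G k i))"
  shows "\<exists>\<gamma>. \<forall>i. infinite {k. \<forall>l\<le>i. G k l = \<gamma> l}"
proof -
  have refine: "\<exists>S'. (infinite S' \<and> (\<exists>v. \<forall>k\<in>S'. G k i = v)) \<and> S' \<subseteq> S" if S: "infinite S" for S i
  proof -
    have "finite ((\<lambda>k. G k i) ` S)" by (rule finite_subset[OF _ assms]) auto
    then obtain k where "infinite {k'\<in>S. G k' i = G k i}" using pigeonhole_infinite[OF S] by blast
    then show ?thesis by (intro exI[of _ "{k'\<in>S. G k' i = G k i}"]) auto
  qed
  have "\<exists>S. \<forall>i. (infinite (S i) \<and> (\<exists>v. \<forall>k\<in>S i. G k i = v)) \<and> S (Suc i) \<subseteq> S i"
  proof (rule dependent_nat_choice)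
    show "\<exists>S. infinite S \<and> (\<exists>v. \<forall>k\<in>S. G k 0 = v)"
      by (rule ex_forward[OF refine[OF infinite_UNIV_nat, of 0]]) (rule conjunct1)
    show "\<exists>S'. (infinite S' \<and> (\<exists>v. \<forall>k\<in>S'. G k (Suc i) = v)) \<and> S' \<subseteq> S"
      if "infinite S \<and> (\<exists>v. \<forall>k\<in>S. G k i = v)" for S i
      by (rule refine[OF conjunct1[OF that]])
  qed
  then obtain S where S0: "\<forall>i. (infinite (S i) \<and> (\<exists>v. \<forall>k\<in>S i. G k i = v)) \<and> S (Suc i) \<subseteq> S i" ..
  then have S: "infinite (S i)" "\<exists>v. \<forall>k\<in>S i. G k i = v" "S (Suc i) \<subseteq> S i" for i by simp_all
  define \<gamma> where "\<gamma> i = (SOME v. \<forall>k\<in>S i. G k i = v)" for i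
  have \<gamma>: "\<forall>k\<in>S i. G k i = \<gamma> i" for i unfolding \<gamma>_def by (rule someI_ex[OF S(2)])
  have mono: "S i \<subseteq> S l" if "l \<le> i" for l i using lift_Suc_antimono_le[of S, OF S(3) that] .
  have "infinite {k. \<forall>l\<le>i. G k l = \<gamma> l}" for i
  proof (rule infinite_super[OF _ S(1)], rule subsetI, intro CollectI allI impI)
    fix k l assume "k \<in> S i" "l \<le> i"
    then have "k \<in> S l" using mono[of l i] by blast
    then show "G k l = \<gamma> l" using \<gamma> by simp
  qed
  then show ?thesis by (intro exI allI)
qed

text \<open>Minimality is tested against \<open>joined\<close> instead of the infimum. It depends
  only on the vertices indexed from i to j, so it passes to subwalks and to limits of
  prefixes.\<close>

definition shortest_walk :: "(edge \<Rightarrow> real) \<Rightarrow> (nat \<Rightarrow> vertex) \<Rightarrow> nat \<Rightarrow> nat \<Rightarrow> bool" where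
  "shortest_walk t \<gamma> i j \<longleftrightarrow> (\<forall>l. i \<le> l \<longrightarrow> l < j \<longrightarrow> adjacent (\<gamma> l) (\<gamma> (Suc l)))
    \<and> (\<forall>c. joined t (\<gamma> i) (\<gamma> j) c \<longrightarrow> cost t \<gamma> i j \<le> c)"

lemma joined_walk:
  assumes "i \<le> j" "\<And>l. i \<le> l \<Longrightarrow> l < j \<Longrightarrow> adjacent (\<gamma> l) (\<gamma> (Suc l))"
  shows "joined t (\<gamma> i) (\<gamma> j) (cost t \<gamma> i j)"
  using assms
proof (induction j rule: dec_induct)
  case base then show ?case by (simp add: cost_def joined.start)
next
  case (step n)
  then have "joined t (\<gamma> i) (\<gamma> n) (cost t \<gamma> i n)" by simp
  then show ?case by (rule joined.extend) (use step in \<open>auto simp: cost_def\<close>)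
qed

lemma joined_path_length:
  assumes "path_between u v p"
  shows "joined t u v (path_length t p)"
proof -
  obtain \<gamma> n where p: "p = map \<gamma> [0..<Suc n]" using path_as_map[OF assms] .
  then have "(\<forall>l<n. adjacent (\<gamma> l) (\<gamma> (Suc l))) \<and> \<gamma> 0 = u \<and> \<gamma> n = v"
    using assms path_between_map[of 0 n u v \<gamma>] by (simp del: upt_Suc)
  then show ?thesis using joined_walk[of 0 n \<gamma> t] by (simp add: p path_length_map del: upt_Suc)
qed

lemma shortest_walk_subwalk:
  assumes "shortest_walk t \<gamma> 0 n" "i \<le> j" "j \<le> n"
  shows "shortest_walk t \<gamma> i j"
  unfolding shortest_walk_def
proof (intro conjI allI impI)
  have adj: "adjacent (\<gamma> l) (\<gamma> (Suc l))" if "l < n" for l using assms(1) that by (simp add: shortest_walk_def)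
  then show "adjacent (\<gamma> l) (\<gamma> (Suc l))" if "i \<le> l" "l < j" for l using that assms by simp
  fix c assume c: "joined t (\<gamma> i) (\<gamma> j) c"
  have "joined t (\<gamma> 0) (\<gamma> i) (cost t \<gamma> 0 i)" "joined t (\<gamma> j) (\<gamma> n) (cost t \<gamma> j n)"
    using assms adj by (auto intro!: joined_walk)
  then have "joined t (\<gamma> 0) (\<gamma> n) (cost t \<gamma> 0 i + c + cost t \<gamma> j n)"
    using joined_trans c by (metis order_refl)
  then have "cost t \<gamma> 0 n \<le> cost t \<gamma> 0 i + c + cost t \<gamma> j n" using assms(1) by (simp add: shortest_walk_def)
  then show "cost t \<gamma> i j \<le> c"
    using cost_split[of 0 i n t \<gamma>] cost_split[of i j n t \<gamma>] assms by simp
qed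

lemma shortest_walk_cong:
  assumes "\<And>l. l \<le> j \<Longrightarrow> \<gamma> l = \<gamma>' l" "i \<le> j"
  shows "shortest_walk t \<gamma> i j \<longleftrightarrow> shortest_walk t \<gamma>' i j"
proof -
  have "cost t \<gamma> i j = cost t \<gamma>' i j" unfolding cost_def using assms by (intro sum.cong) auto
  then show ?thesis unfolding shortest_walk_def using assms by auto
qed

section \<open>Existence of geodesics and of a ray in the north-east quadrant\<close>

context hierarchy
begin

text \<open>Every edge costs at least 1, so the competitors of p0 have boundedly many vertices and
  stay in a finite ball; a minimum over finitely many paths exists.\<close>

lemma geodesic_exists:
  assumes "path_between u v p0"
  obtains p where "path_between u v p" "\<And>q. path_between u v q \<Longrightarrow> path_length t p \<le> path_length t q"
proof -
  have len: "real (length p - 1) \<le> path_length t p" if "path_between u v p" for p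
  proof -
    have "(\<Sum>i<length p - 1. 1::real) \<le> path_length t p" unfolding path_length_def
      by (intro sum_mono edge_ge_1) (use that in \<open>auto simp: path_between_def lattice_path_def\<close>)
    then show ?thesis by simp
  qed
  define M where "M = Suc (nat \<lceil>path_length t p0\<rceil>)"
  define V where "V = {v. l1_norm v \<le> l1_norm u + int M}"
  define S where "S = {p. path_between u v p \<and> length p \<le> M}"
  have "V \<subseteq> {- (l1_norm u + int M)..l1_norm u + int M} \<times> {- (l1_norm u + int M)..l1_norm u + int M}"
    unfolding V_def l1_norm_def by auto
  then have "finite V" by (rule finite_subset) simp
  moreover have "S \<subseteq> {p. set p \<subseteq> V \<and> length p \<le> M}"
  proof
    fix p assume p: "p \<in> S"
    have "l1_norm (p ! i) \<le> l1_norm u + int i" if "i < length p" for i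
      using that
    proof (induction i)
      case 0 then show ?case using p by (simp add: S_def path_between_def hd_conv_nth)
    next
      case (Suc i)
      then have "adjacent (p ! i) (p ! Suc i)" using p by (simp add: S_def path_between_def lattice_path_def)
      then have "l1_norm (p ! Suc i) \<le> l1_norm (p ! i) + 1" unfolding adjacent_iff l1_norm_def by linarith
      then show ?case using Suc by simp
    qed
    then have "set p \<subseteq> V" using p by (force simp: V_def S_def in_set_conv_nth)
    then show "p \<in> {p. set p \<subseteq> V \<and> length p \<le> M}" using p by (simp add: S_def)
  qed
  ultimately have "finite S" using finite_lists_length_le finite_subset by blast
  have bound: "q \<in> S \<or> path_length t p0 \<le> path_length t q" if "path_between u v q" for q
    using len[OF that] that unfolding S_def M_def by auto linarith
  have p0: "p0 \<in> S" using len[OF assms] assms unfolding S_def M_def by auto linarith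
  obtain p where p: "p \<in> S" "\<And>q. q \<in> S \<Longrightarrow> path_length t p \<le> path_length t q"
    using ex_min_if_finite[of "path_length t ` S"] \<open>finite S\<close> p0 by (auto simp: not_less)
  show ?thesis by (rule that[of p]) (use p bound p0 in \<open>force simp: S_def\<close>)+
qed

lemma geodesic_ray_if_shortest:
  assumes "\<And>i j. i \<le> j \<Longrightarrow> shortest_walk t \<gamma> i j"
  shows "geodesic_ray t \<gamma>"
  unfolding geodesic_ray_def geodesic_def
proof (intro allI impI)
  fix i j :: nat assume "i \<le> j"
  then have sh: "shortest_walk t \<gamma> i j" by (rule assms)
  have path: "path_between (\<gamma> i) (\<gamma> j) (map \<gamma> [i..<Suc j])"
    using sh \<open>i \<le> j\<close> by (simp add: path_between_map shortest_walk_def del: upt_Suc)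
  have "cost t \<gamma> i j \<le> passage_time t (\<gamma> i) (\<gamma> j)"
    unfolding passage_time_def
    by (rule cINF_greatest) (use sh path joined_path_length in \<open>auto simp: shortest_walk_def\<close>)
  then show "path_between (\<gamma> i) (\<gamma> j) (map \<gamma> [i..<Suc j]) \<and>
      path_length t (map \<gamma> [i..<Suc j]) = passage_time t (\<gamma> i) (\<gamma> j)"
    using path passage_time_le[OF path] \<open>i \<le> j\<close> by (simp add: path_length_map del: upt_Suc)
qed

text \<open>The signed sum x + y replaces the l^1-norm: a bound on this defect allows only finitely
  many steps other than \<open>\<e>1\<close> and \<open>\<e>2\<close>, which also identifies the
  quadrant of the limit.\<close>

lemma northeast_defect_mono:
  assumes "\<And>l. i \<le> l \<Longrightarrow> l < j \<Longrightarrow> adjacent (\<gamma> l) (\<gamma> (Suc l))" "i \<le> j"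
  shows "int i - (fst (\<gamma> i) + snd (\<gamma> i)) \<le> int j - (fst (\<gamma> j) + snd (\<gamma> j))"
  using assms(2,1)
proof (induction j rule: dec_induct)
  case (step n)
  have "\<bar>fst (\<gamma> n) - fst (\<gamma> (Suc n))\<bar> + \<bar>snd (\<gamma> n) - snd (\<gamma> (Suc n))\<bar> = 1"
    using step by (simp add: adjacent_iff)
  moreover have "int i - (fst (\<gamma> i) + snd (\<gamma> i)) \<le> int n - (fst (\<gamma> n) + snd (\<gamma> n))"
    using step by simp
  ultimately show ?case unfolding of_nat_Suc by linarith
qed simp

text \<open>The number of edges is at most the cost of a geodesic, which the climb of
  \<open>joined_corner\<close> bounds.\<close>

lemma walk_to_corner:
  obtains n \<gamma> where "shortest_walk t \<gamma> 0 n" "\<gamma> 0 = (0, 0)"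
    "\<gamma> n = (int (nearest a k), int (nearest b k))"
    "real n \<le> real (nearest a k) + real (nearest b k) + slack \<alpha>"
proof -
  let ?c = "(int (nearest a k), int (nearest b k))"
  obtain p0 where "path_between (0, 0) ?c p0" using joined_path[OF joined_corner] by blast
  then obtain p where p: "path_between (0, 0) ?c p"
    "\<And>q. path_between (0, 0) ?c q \<Longrightarrow> path_length t p \<le> path_length t q"
    using geodesic_exists by blast
  obtain \<gamma> n where pm: "p = map \<gamma> [0..<Suc n]" using path_as_map[OF p(1)] .
  then have \<gamma>: "(\<forall>l<n. adjacent (\<gamma> l) (\<gamma> (Suc l))) \<and> \<gamma> 0 = (0, 0) \<and> \<gamma> n = ?c"
    using p(1) path_between_map[of 0 n "(0, 0)" ?c \<gamma>] by (simp del: upt_Suc)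
  have min: "cost t \<gamma> 0 n \<le> c" if "joined t (0, 0) ?c c" for c
    using joined_path[OF that] p(2) by (force simp: pm path_length_map simp del: upt_Suc)
  show ?thesis
  proof (rule that)
    show "shortest_walk t \<gamma> 0 n" using \<gamma> min by (simp add: shortest_walk_def)
    have "real n \<le> cost t \<gamma> 0 n" using cost_ge_length[of 0 n \<gamma>] \<gamma> by simp
    then show "real n \<le> real (nearest a k) + real (nearest b k) + slack \<alpha>" using min[OF joined_corner] by simp
  qed (use \<gamma> in auto)
qed

lemma northeast_ray_exists: "\<exists>\<gamma>. geodesic_ray t \<gamma> \<and> \<gamma> 0 = (0, 0) \<and> eventually_northeast \<gamma>"
proof -
  have "\<forall>k. \<exists>n \<gamma>. shortest_walk t \<gamma> 0 n \<and> \<gamma> 0 = (0, 0) \<and> \<gamma> n = (int (nearest a k), int (nearest b k))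
      \<and> real n \<le> real (nearest a k) + real (nearest b k) + slack \<alpha>"
    using walk_to_corner by metis
  then obtain n G0 where G0: "\<And>k. shortest_walk t (G0 k) 0 (n k)" "\<And>k. G0 k 0 = (0, 0)"
    "\<And>k. G0 k (n k) = (int (nearest a k), int (nearest b k))"
    "\<And>k. real (n k) \<le> real (nearest a k) + real (nearest b k) + slack \<alpha>"
    by metis
  \<comment> \<open>Each walk is frozen at its corner, to be defined at all times.\<close>
  define G where "G k i = G0 k (min i (n k))" for k i
  have adj: "adjacent (G0 k l) (G0 k (Suc l))" if "l < n k" for k l
    using G0(1) that by (simp add: shortest_walk_def)
  have l1: "l1_norm (G0 k i) \<le> int i" if "i \<le> n k" for k i
    using that
  proof (induction i)
    case 0 then show ?case using G0(2) by (simp add: l1_norm_def)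
  next
    case (Suc i)
    then show ?case using adj[of i k] unfolding adjacent_iff l1_norm_def by simp
  qed
  have "finite (range (\<lambda>k. G k i))" for i
  proof (rule finite_subset)
    have "l1_norm (G k i) \<le> int i" for k using l1[of "min i (n k)" k] by (simp add: G_def)
    then have "\<bar>fst (G k i)\<bar> \<le> int i \<and> \<bar>snd (G k i)\<bar> \<le> int i" for k
      unfolding l1_norm_def by (meson abs_ge_zero add_increasing add_increasing2 le_add_same_cancel1 le_add_same_cancel2 order_trans)
    then show "range (\<lambda>k. G k i) \<subseteq> {- int i..int i} \<times> {- int i..int i}"
      by (intro image_subsetI) (simp add: mem_Times_iff abs_le_iff minus_le_iff)
  qed simp
  then obtain \<gamma> where \<gamma>: "\<And>i. infinite {k. \<forall>l\<le>i. G k l = \<gamma> l}" using constant_on_prefixes by blast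
  \<comment> \<open>The walk to \<open>c_k\<close> has at least \<open>nearest a k\<close> steps;
    for large k the freezing does not affect the prefix up to j.\<close>
  have approx: "\<exists>k. j \<le> n k \<and> (\<forall>l\<le>j. G0 k l = \<gamma> l)" for j
  proof -
    obtain K where K: "\<And>k. K \<le> k \<Longrightarrow> int j < int (nearest a k)" using nearest_unbounded[OF col_levels] by blast
    obtain k where k: "K \<le> k" "\<forall>l\<le>j. G k l = \<gamma> l"
      using \<gamma>[of j] unfolding infinite_nat_iff_unbounded_le by blast
    have "int (nearest a k) \<le> int (n k)" using l1[of "n k" k] G0(3)[of k] by (simp add: l1_norm_def)
    then have "j \<le> n k" using K[OF k(1)] by simp
    moreover have "G0 k l = \<gamma> l" if "l \<le> j" for l using k(2) that \<open>j \<le> n k\<close> by (auto simp: G_def min_def)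
    ultimately show ?thesis by blast
  qed
  have ray: "geodesic_ray t \<gamma>"
  proof (rule geodesic_ray_if_shortest)
    fix i j :: nat assume "i \<le> j"
    obtain k where k: "j \<le> n k" "\<forall>l\<le>j. G0 k l = \<gamma> l" using approx by blast
    then show "shortest_walk t \<gamma> i j"
      using shortest_walk_subwalk[OF G0(1) \<open>i \<le> j\<close> k(1)] shortest_walk_cong[of j "G0 k" \<gamma> i t] \<open>i \<le> j\<close> by simp
  qed
  have origin: "\<gamma> 0 = (0, 0)" using approx[of 0] G0(2) by auto
  define f where "f i = int i - (fst (\<gamma> i) + snd (\<gamma> i))" for i
  \<comment> \<open>The defect at time i is at most the defect at the corner, which is at most
    \<open>slack \<alpha>\<close> uniformly in k.\<close>
  have "f i \<le> \<lceil>slack \<alpha>\<rceil>" for i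
  proof -
    obtain k where k: "i \<le> n k" "\<forall>l\<le>i. G0 k l = \<gamma> l" using approx by blast
    have "f i \<le> int (n k) - (int (nearest a k) + int (nearest b k))"
      using northeast_defect_mono[of i "n k" "G0 k"] adj k G0(3)[of k] by (simp add: f_def)
    then have "real_of_int (f i) \<le> real_of_int (int (n k) - (int (nearest a k) + int (nearest b k)))"
      by (simp only: of_int_le_iff)
    also have "\<dots> \<le> slack \<alpha>" using G0(4)[of k] by simp
    finally show ?thesis by (meson le_of_int_ceiling of_int_le_iff order_trans)
  qed
  moreover have "f i \<le> f (Suc i)" for i
    using northeast_defect_mono[of i "Suc i" \<gamma>] ray_adjacent[OF ray] by (simp add: f_def)
  ultimately obtain N where N: "\<And>i. N \<le> i \<Longrightarrow> f i = f N" using bounded_mono_eventually_const by metis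
  have "\<gamma> (Suc i) = \<gamma> i + \<e>1 \<or> \<gamma> (Suc i) = \<gamma> i + \<e>2" if "N \<le> i" for i
  proof -
    have "fst (\<gamma> (Suc i)) + snd (\<gamma> (Suc i)) = fst (\<gamma> i) + snd (\<gamma> i) + 1"
      using N[OF that] N[of "Suc i"] that unfolding f_def by simp
    moreover have "\<bar>fst (\<gamma> i) - fst (\<gamma> (Suc i))\<bar> + \<bar>snd (\<gamma> i) - snd (\<gamma> (Suc i))\<bar> = 1"
      using ray_adjacent[OF ray, of i] by (simp add: adjacent_iff)
    ultimately have "(fst (\<gamma> (Suc i)) = fst (\<gamma> i) + 1 \<and> snd (\<gamma> (Suc i)) = snd (\<gamma> i)) \<or>
      (fst (\<gamma> (Suc i)) = fst (\<gamma> i) \<and> snd (\<gamma> (Suc i)) = snd (\<gamma> i) + 1)" by linarith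
    then show ?thesis by (auto simp: prod_eq_iff \<e>1_def \<e>2_def)
  qed
  then show ?thesis using ray origin unfolding eventually_northeast_def by blast
qed

section \<open>Counting rays by quadrants\<close>

definition quadrant :: "int \<times> int \<Rightarrow> (nat \<Rightarrow> vertex) set" where
  "quadrant q = {\<gamma> \<in> origin_rays t. eventually_northeast (reflect (fst q) (snd q) \<circ> \<gamma>)}"

lemma quadrant_nonempty:
  assumes "q \<in> {1, -1} \<times> {1, -1}"
  shows "quadrant q \<noteq> {}"
proof -
  obtain r s where q: "q = (r, s)" and rs: "r \<in> {1, -1}" "s \<in> {1, -1}" using assms by auto
  interpret R: lattice_involution "reflect r s" using reflect_involution rs by blast
  obtain \<gamma> where \<gamma>: "geodesic_ray (pullback (reflect r s) t) \<gamma>" "\<gamma> 0 = (0, 0)" "eventually_northeast \<gamma>"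
    using hierarchy.northeast_ray_exists[OF hierarchy_reflect[OF rs]] by blast
  have "reflect r s \<circ> (reflect r s \<circ> \<gamma>) = \<gamma>" by (simp add: fun_eq_iff R.involution)
  then have "reflect r s \<circ> \<gamma> \<in> quadrant q"
    using \<gamma> by (simp add: quadrant_def origin_rays_def q R.geodesic_ray_image) (simp add: reflect_def)
  then show ?thesis by blast
qed

lemma quadrant_sign:
  assumes "\<gamma> \<in> quadrant q" "q \<in> {1, -1} \<times> {1, -1}"
  shows "\<exists>N. \<forall>n\<ge>N. 0 < fst q * fst (\<gamma> n) \<and> 0 < snd q * snd (\<gamma> n)"
proof -
  obtain r s where q: "q = (r, s)" and rs: "r \<in> {1, -1}" "s \<in> {1, -1}" using assms(2) by auto
  interpret R: lattice_involution "reflect r s" using reflect_involution rs by blast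
  have ray: "geodesic_ray (pullback (reflect r s) t) (reflect r s \<circ> \<gamma>)"
    using assms(1) by (simp add: quadrant_def origin_rays_def q R.geodesic_ray_image')
  obtain N where "northeast_walk (reflect r s \<circ> \<gamma>) N"
    using assms(1) by (auto simp: quadrant_def q eventually_northeast_def northeast_walk_def)
  then interpret northeast_walk "reflect r s \<circ> \<gamma>" N .
  obtain n1 n2 where n: "N \<le> n1" "0 < fst ((reflect r s \<circ> \<gamma>) n1)" "N \<le> n2" "0 < snd ((reflect r s \<circ> \<gamma>) n2)"
    using hierarchy.northeast_reaches[OF hierarchy_reflect[OF rs] ray northeast_walk_axioms] by blast
  have "0 < r * fst (\<gamma> n) \<and> 0 < s * snd (\<gamma> n)" if "max n1 n2 \<le> n" for n
    using coordinates_mono(1)[of n1 n] coordinates_mono(2)[of n2 n] n that by (simp add: reflect_def)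
  then show ?thesis unfolding q by (intro exI[of _ "max n1 n2"]) simp
qed

lemma quadrant_cover:
  assumes "\<gamma> \<in> origin_rays t"
  shows "\<exists>q\<in>{1, -1} \<times> {1, -1}. \<gamma> \<in> quadrant q"
  using ray_in_quadrant[of \<gamma>] assms by (force simp: quadrant_def origin_rays_def)

lemma same_quadrant_not_distinct:
  assumes \<gamma>: "\<gamma> \<in> quadrant q" "\<gamma>' \<in> quadrant q" and q: "q \<in> {1, -1} \<times> {1, -1}"
    and switches: "infinite (level_switches (\<lambda>x. a (fst q * x)) (\<lambda>y. b (snd q * y)))"
  shows "\<not> distinct_rays \<gamma> \<gamma>'"
proof
  assume "distinct_rays \<gamma> \<gamma>'"
  then have fin: "finite (common_steps \<gamma> \<gamma>')" by (rule finite_common_steps)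
  let ?R = "reflect (fst q) (snd q)"
  have rs: "fst q \<in> {1, -1}" "snd q \<in> {1, -1}" using q by (auto simp: mem_Times_iff)
  interpret R: lattice_involution ?R using reflect_involution rs by blast
  have "infinite (common_steps (?R \<circ> \<gamma>) (?R \<circ> \<gamma>'))"
    by (rule hierarchy.northeast_common_steps[OF hierarchy_reflect[OF rs]])
      (use \<gamma> switches in \<open>simp_all add: quadrant_def origin_rays_def R.geodesic_ray_image'\<close>)
  moreover have "common_steps (?R \<circ> \<gamma>) (?R \<circ> \<gamma>') \<subseteq> map_prod ?R ?R ` common_steps \<gamma> \<gamma>'"
  proof
    fix e assume "e \<in> common_steps (?R \<circ> \<gamma>) (?R \<circ> \<gamma>')"
    then obtain n m where "e = (?R (\<gamma> n), ?R (\<gamma> (Suc n)))" "e = (?R (\<gamma>' m), ?R (\<gamma>' (Suc m)))"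
      unfolding common_steps_def comp_def by blast
    moreover from this have "\<gamma> n = \<gamma>' m" "\<gamma> (Suc n) = \<gamma>' (Suc m)" by (metis R.involution prod.inject)+
    moreover from this have "(\<gamma> n, \<gamma> (Suc n)) \<in> common_steps \<gamma> \<gamma>'"
      unfolding common_steps_def by (intro IntI rangeI range_eqI[of _ _ m]) simp
    ultimately show "e \<in> map_prod ?R ?R ` common_steps \<gamma> \<gamma>'"
      by (intro image_eqI[of _ _ "(\<gamma> n, \<gamma> (Suc n))"]) simp_all
  qed
  ultimately show False using fin finite_surj by blast
qed

text \<open>Eventually the rays lie in disjoint open quadrants, so a shared edge is traversed by one
  of them at one of finitely many early times.\<close>

lemma different_quadrant_distinct:
  assumes \<gamma>: "\<gamma> \<in> quadrant q" "\<gamma>' \<in> quadrant q'"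
    and q: "q \<in> {1, -1} \<times> {1, -1}" "q' \<in> {1, -1} \<times> {1, -1}" "q \<noteq> q'"
  shows "distinct_rays \<gamma> \<gamma>'" "\<gamma> \<noteq> \<gamma>'"
proof -
  obtain N where N: "\<And>n. N \<le> n \<Longrightarrow> 0 < fst q * fst (\<gamma> n) \<and> 0 < snd q * snd (\<gamma> n)"
    using quadrant_sign[OF \<gamma>(1) q(1)] by blast
  obtain N' where N': "\<And>n. N' \<le> n \<Longrightarrow> 0 < fst q' * fst (\<gamma>' n) \<and> 0 < snd q' * snd (\<gamma>' n)"
    using quadrant_sign[OF \<gamma>(2) q(2)] by blast
  have ne: "\<gamma> n \<noteq> \<gamma>' m" if "N \<le> n" "N' \<le> m" for n m
  proof
    assume "\<gamma> n = \<gamma>' m"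
    then show False using N[OF that(1)] N'[OF that(2)] q by (auto simp: mem_Times_iff prod_eq_iff)
  qed
  show "\<gamma> \<noteq> \<gamma>'" using ne[of "max N N'" "max N N'"] by auto
  let ?e = "\<lambda>\<gamma> n. edge_between (\<gamma> n) (\<gamma> (Suc n))"
  have "ray_edges \<gamma> \<inter> ray_edges \<gamma>' \<subseteq> ?e \<gamma> ` {..<N} \<union> ?e \<gamma>' ` {..<N'}"
  proof
    fix e assume "e \<in> ray_edges \<gamma> \<inter> ray_edges \<gamma>'"
    then obtain n m where e: "e = ?e \<gamma> n" "e = ?e \<gamma>' m" unfolding ray_edges_def by blast
    have "n < N \<or> m < N'"
    proof (rule ccontr)
      assume "\<not> ?thesis"
      then have "\<gamma> n \<noteq> \<gamma>' m" "\<gamma> n \<noteq> \<gamma>' (Suc m)" using ne by auto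
      then show False using e by (auto simp: edge_between_def split: if_splits)
    qed
    then show "e \<in> ?e \<gamma> ` {..<N} \<union> ?e \<gamma>' ` {..<N'}"
    proof
      assume "n < N"
      then show ?thesis using e(1) by blast
    next
      assume "m < N'"
      then show ?thesis using e(2) by blast
    qed
  qed
  then show "distinct_rays \<gamma> \<gamma>'" unfolding distinct_rays_def by (rule finite_subset) simp
qed

text \<open>Choosing a quadrant for each ray is injective on a pairwise distinct family, giving the
  upper bound; one ray from each quadrant gives the lower bound.\<close>

theorem num_distinct_rays_eq_4:
  assumes "\<And>r s. r \<in> {1, -1} \<Longrightarrow> s \<in> {1, -1} \<Longrightarrow> infinite (level_switches (\<lambda>x. a (r * x)) (\<lambda>y. b (s * y)))"
  shows "num_distinct_rays (origin_rays t) = 4"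
proof (rule antisym)
  define Q :: "(int \<times> int) set" where "Q = {1, -1} \<times> {1, -1}"
  have four: "finite Q" "card Q = 4" by (simp_all add: Q_def card_cartesian_product)
  have same: "\<not> distinct_rays \<gamma> \<gamma>'" if "\<gamma> \<in> quadrant q" "\<gamma>' \<in> quadrant q" "q \<in> Q" for \<gamma> \<gamma>' q
    by (rule same_quadrant_not_distinct[OF that(1,2) _ assms]) (use that in \<open>auto simp: Q_def mem_Times_iff\<close>)
  have "enat (card S) \<le> 4" if S: "S \<subseteq> origin_rays t" "pairwise distinct_rays S" for S
  proof -
    obtain f where f: "\<And>\<gamma>. \<gamma> \<in> S \<Longrightarrow> f \<gamma> \<in> Q \<and> \<gamma> \<in> quadrant (f \<gamma>)"
      using quadrant_cover S(1) unfolding Q_def by (metis subsetD)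
    have "inj_on f S"
    proof (rule inj_onI, rule ccontr)
      fix \<gamma> \<gamma>' assume *: "\<gamma> \<in> S" "\<gamma>' \<in> S" "f \<gamma> = f \<gamma>'" "\<gamma> \<noteq> \<gamma>'"
      then have "distinct_rays \<gamma> \<gamma>'" using S(2) by (simp add: pairwise_def)
      then show False using same[of \<gamma> "f \<gamma>" \<gamma>'] f[OF *(1)] f[OF *(2)] * by simp
    qed
    then have "card S \<le> card Q" using f by (intro card_inj_on_le[of f] four) auto
    then have "card S \<le> 4" by (simp only: four(2))
    then show ?thesis by (simp add: numeral_eq_enat)
  qed
  then show "num_distinct_rays (origin_rays t) \<le> 4"
    unfolding num_distinct_rays_def by (intro SUP_least) auto
  define g where "g q = (SOME \<gamma>. \<gamma> \<in> quadrant q)" for q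
  have g: "g q \<in> quadrant q" if "q \<in> Q" for q
    unfolding g_def using quadrant_nonempty[of q] that by (intro some_in_eq[THEN iffD2]) (simp add: Q_def)
  have "inj_on g Q"
    by (rule inj_onI) (use g different_quadrant_distinct(2) in \<open>unfold Q_def, metis\<close>)
  then have "card (g ` Q) = 4" by (simp only: card_image four(2))
  moreover have "g ` Q \<in> {S. S \<subseteq> origin_rays t \<and> finite S \<and> pairwise distinct_rays S}"
  proof (intro CollectI conjI)
    show "g ` Q \<subseteq> origin_rays t" using g by (auto simp: quadrant_def)
    show "pairwise distinct_rays (g ` Q)"
    proof (rule pairwiseI)
      fix \<gamma> \<gamma>' assume "\<gamma> \<in> g ` Q" "\<gamma>' \<in> g ` Q" "\<gamma> \<noteq> \<gamma>'"
      then obtain q q' where "q \<in> Q" "q' \<in> Q" "\<gamma> = g q" "\<gamma>' = g q'" "q \<noteq> q'" by blast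
      then show "distinct_rays \<gamma> \<gamma>'" using different_quadrant_distinct(1)[OF g g] by (simp add: Q_def)
    qed
  qed (simp add: four)
  ultimately show "4 \<le> num_distinct_rays (origin_rays t)"
    unfolding num_distinct_rays_def by (intro SUP_upper2[of "g ` Q"]) (simp_all add: numeral_eq_enat)
qed

end

subsection \<open>The adding machine\<close>

text \<open>The residue modulo \<open>5 ^ j\<close> of the 5-adic integer with digits \<omega> 1,
  \<omega> 2, and so on. The adding machine is addition of 1 on these integers.\<close>

definition digit_value :: "(nat \<Rightarrow> nat) \<Rightarrow> nat \<Rightarrow> int" where
  "digit_value \<omega> j = (\<Sum>i<j. int (\<omega> (Suc i)) * 5 ^ i)"

lemma digit_le_4: "\<omega> \<in> digit_seqs \<Longrightarrow> \<omega> (Suc i) \<le> 4"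
  by (auto simp: digit_seqs_def PiE_iff dest!: bspec[of _ _ "Suc i"])

lemma digit_value_bounds:
  assumes "\<omega> \<in> digit_seqs"
  shows "0 \<le> digit_value \<omega> j" "digit_value \<omega> j < 5 ^ j"
proof -
  show "0 \<le> digit_value \<omega> j" unfolding digit_value_def by (intro sum_nonneg) simp
  show "digit_value \<omega> j < 5 ^ j"
  proof (induction j)
    case (Suc j)
    have "int (\<omega> (Suc j)) * 5 ^ j \<le> 4 * 5 ^ j" using digit_le_4[OF assms, of j] by (intro mult_right_mono) auto
    moreover have "digit_value \<omega> (Suc j) = digit_value \<omega> j + int (\<omega> (Suc j)) * 5 ^ j" by (simp add: digit_value_def)
    ultimately show ?case using Suc unfolding power_Suc by linarith
  qed (simp add: digit_value_def)
qed

lemma digit_value_Suc: "digit_value \<omega> (Suc j) = digit_value \<omega> j + int (\<omega> (Suc j)) * 5 ^ j"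
  by (simp add: digit_value_def)

lemma zero_prefix_iff:
  assumes "\<omega> \<in> digit_seqs"
  shows "(\<forall>i\<in>{1..j}. \<omega> i = 0) \<longleftrightarrow> 5 ^ j dvd digit_value \<omega> j"
proof -
  have "(\<forall>i\<in>{1..j}. \<omega> i = 0) \<longleftrightarrow> (\<forall>i<j. \<omega> (Suc i) = 0)"
    by (metis Suc_le_eq Suc_pred atLeastAtMost_iff le_numeral_extra(4) less_eq_Suc_le not_less_eq_eq One_nat_def le_add1 plus_1_eq_Suc)
  also have "\<dots> \<longleftrightarrow> digit_value \<omega> j = 0"
    unfolding digit_value_def by (subst sum_nonneg_eq_0_iff) auto
  also have "\<dots> \<longleftrightarrow> 5 ^ j dvd digit_value \<omega> j"
    using digit_value_bounds[OF assms, of j] zdvd_imp_le[of "5 ^ j" "digit_value \<omega> j"] by fastforce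
  finally show ?thesis .
qed

lemma adding_machine_in: "\<omega> \<in> digit_seqs \<Longrightarrow> adding_machine \<omega> \<in> digit_seqs"
  by (auto simp: digit_seqs_def adding_machine_def PiE_iff)

text \<open>The correction \<open>5 ^ j\<close> appears exactly when the carry leaves the first j
  digits; this is also the condition for digit j + 1 to change.\<close>

lemma digit_value_adding_machine:
  assumes "\<omega> \<in> digit_seqs"
  shows "digit_value (adding_machine \<omega>) j
    = digit_value \<omega> j + 1 - (if \<forall>i\<in>{1..<Suc j}. \<omega> i = 4 then 5 ^ j else 0)"
proof (induction j)
  case 0 then show ?case by (simp add: digit_value_def)
next
  case (Suc j)
  have digit: "adding_machine \<omega> (Suc j) = (if \<forall>i\<in>{1..<Suc j}. \<omega> i = 4 then (\<omega> (Suc j) + 1) mod 5 else \<omega> (Suc j))"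
    by (simp add: adding_machine_def)
  have all: "(\<forall>i\<in>{1..<Suc (Suc j)}. \<omega> i = 4) \<longleftrightarrow> (\<forall>i\<in>{1..<Suc j}. \<omega> i = 4) \<and> \<omega> (Suc j) = 4"
    by (auto simp: less_Suc_eq)
  consider "\<omega> (Suc j) = 4" | "\<omega> (Suc j) < 4" using digit_le_4[OF assms, of j] by linarith
  then show ?case
  proof cases
    case 1
    then show ?thesis unfolding digit_value_Suc digit all Suc by (simp add: algebra_simps)
  next
    case 2
    then show ?thesis unfolding digit_value_Suc digit all Suc by (simp add: algebra_simps)
  qed
qed

text \<open>Makes \<open>inv_into\<close> a right inverse on all digit sequences, which is how
  negative powers are evaluated.\<close>

lemma adding_machine_surj:
  assumes "\<omega> \<in> digit_seqs"
  shows "\<omega> \<in> adding_machine ` digit_seqs"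
proof
  \<comment> \<open>Subtraction of 1 with borrow: adding 4 modulo 5 as long as all earlier digits
    are 0.\<close>
  define \<psi> where "\<psi> = (\<lambda>i\<in>{1..}. if \<forall>j\<in>{1..<i}. \<omega> j = 0 then (\<omega> i + 4) mod 5 else \<omega> i)"
  show \<psi>: "\<psi> \<in> digit_seqs" using assms by (auto simp: digit_seqs_def \<psi>_def PiE_iff)
  have le4: "\<omega> i \<le> 4" if "1 \<le> i" for i using digit_le_4[OF assms, of "i - 1"] that by simp
  have prefix: "(\<forall>j\<in>{1..<i}. \<psi> j = 4) \<longleftrightarrow> (\<forall>j\<in>{1..<i}. \<omega> j = 0)" for i
  proof (induction i)
    case (Suc i)
    show ?case
    proof (cases "1 \<le> i")
      case True
      then have split: "{1..<Suc i} = insert i {1..<i}" by auto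
      have "\<psi> i = 4 \<longleftrightarrow> \<omega> i = 0" if "\<forall>j\<in>{1..<i}. \<omega> j = 0"
      proof -
        have "\<psi> i = (\<omega> i + 4) mod 5" using that True by (simp add: \<psi>_def)
        moreover have "\<omega> i \<in> {0, 1, 2, 3, 4}" using le4[OF True] by auto
        ultimately show ?thesis by auto
      qed
      then show ?thesis unfolding split using Suc by auto
    qed (simp add: not_le)
  qed simp
  show "\<omega> = adding_machine \<psi>"
  proof
    fix i
    show "\<omega> i = adding_machine \<psi> i"
    proof (cases "1 \<le> i")
      case True
      have "\<omega> i \<in> {0, 1, 2, 3, 4}" using le4[OF True] by auto
      then show ?thesis using True unfolding adding_machine_def prefix by (auto simp: \<psi>_def)
    next
      case False
      then show ?thesis using assms by (auto simp: adding_machine_def digit_seqs_def PiE_def extensional_def)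
    qed
  qed
qed

lemma adding_machine_pow_value:
  assumes "\<omega> \<in> digit_seqs"
  shows "adding_machine_pow n \<omega> \<in> digit_seqs
    \<and> 5 ^ j dvd digit_value (adding_machine_pow n \<omega>) j - (digit_value \<omega> j + n)"
proof -
  have one: "5 ^ j dvd digit_value (adding_machine \<psi>) j - (digit_value \<psi> j + 1)" if "\<psi> \<in> digit_seqs" for \<psi>
    unfolding digit_value_adding_machine[OF that] by simp
  show ?thesis
  proof (cases "0 \<le> n")
    case True
    have "(adding_machine ^^ m) \<omega> \<in> digit_seqs
      \<and> 5 ^ j dvd digit_value ((adding_machine ^^ m) \<omega>) j - (digit_value \<omega> j + int m)" for m
    proof (induction m)
      case (Suc m)
      then have "5 ^ j dvd (digit_value (adding_machine ((adding_machine ^^ m) \<omega>)) j - (digit_value ((adding_machine ^^ m) \<omega>) j + 1))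
        + (digit_value ((adding_machine ^^ m) \<omega>) j - (digit_value \<omega> j + int m))"
        using one by (intro dvd_add) auto
      then show ?case using Suc adding_machine_in by (simp add: algebra_simps)
    qed (use assms in simp)
    from this[of "nat n"] show ?thesis using True by (simp add: adding_machine_pow_def)
  next
    case False
    let ?\<tau> = "inv_into digit_seqs adding_machine"
    have "(?\<tau> ^^ m) \<omega> \<in> digit_seqs
      \<and> 5 ^ j dvd digit_value ((?\<tau> ^^ m) \<omega>) j - (digit_value \<omega> j - int m)" for m
    proof (induction m)
      case (Suc m)
      let ?\<psi> = "(?\<tau> ^^ m) \<omega>"
      have in': "?\<tau> ?\<psi> \<in> digit_seqs" and eq: "adding_machine (?\<tau> ?\<psi>) = ?\<psi>"
        using Suc adding_machine_surj inv_into_into f_inv_into_f by metis+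
      have "5 ^ j dvd (digit_value ?\<psi> j - (digit_value \<omega> j - int m)) - (digit_value ?\<psi> j - (digit_value (?\<tau> ?\<psi>) j + 1))"
        using one[OF in'] Suc unfolding eq by (metis dvd_diff)
      then show ?case using in' by (simp add: algebra_simps)
    qed (use assms in simp)
    from this[of "nat (- n)"] show ?thesis using False by (simp add: adding_machine_pow_def)
  qed
qed

text \<open>One plus the 5-adic valuation of \<omega> + n, using finite digit sums and no power of
  the adding machine, so that measurability is immediate. The index 0 never qualifies, as 1 divides
  everything; the default 1 matches \<open>first_nonzero\<close>.\<close>

definition orbit_level :: "(nat \<Rightarrow> nat) \<Rightarrow> int \<Rightarrow> nat" where
  "orbit_level \<omega> n = (if \<exists>i. \<not> 5 ^ i dvd digit_value \<omega> i + n
     then LEAST i. \<not> 5 ^ i dvd digit_value \<omega> i + n else 1)"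

lemma first_nonzero_pow:
  assumes "\<omega> \<in> digit_seqs"
  shows "first_nonzero (adding_machine_pow n \<omega>) = orbit_level \<omega> n"
proof -
  let ?\<psi> = "adding_machine_pow n \<omega>"
  have *: "5 ^ i dvd digit_value \<omega> i + n \<longleftrightarrow> (\<forall>l\<in>{1..i}. ?\<psi> l = 0)" for i
  proof -
    have \<psi>: "?\<psi> \<in> digit_seqs" and dvd: "5 ^ i dvd digit_value ?\<psi> i - (digit_value \<omega> i + n)"
      using adding_machine_pow_value[OF assms] by blast+
    show ?thesis
      unfolding zero_prefix_iff[OF \<psi>]
      using dvd_add_right_iff[OF dvd, of "digit_value \<omega> i + n"] by (simp only: diff_add_cancel)
  qed
  have ex_iff: "(\<exists>i\<ge>1. 0 < ?\<psi> i) \<longleftrightarrow> (\<exists>i. \<not> (\<forall>l\<in>{1..i}. ?\<psi> l = 0))"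
  proof
    assume "\<exists>i\<ge>1. 0 < ?\<psi> i"
    then obtain i where i: "i \<in> {1..i}" "?\<psi> i \<noteq> 0" by auto
    show "\<exists>i. \<not> (\<forall>l\<in>{1..i}. ?\<psi> l = 0)" by (rule exI[of _ i]) (use i bspec[OF _ i(1)] in auto)
  qed auto
  have least: "(LEAST i. i \<ge> 1 \<and> 0 < ?\<psi> i) = (LEAST i. \<not> (\<forall>l\<in>{1..i}. ?\<psi> l = 0))"
    if ex: "\<exists>i\<ge>1. 0 < ?\<psi> i"
  proof (rule Least_equality[symmetric])
    let ?m = "LEAST i. i \<ge> 1 \<and> 0 < ?\<psi> i"
    have m: "1 \<le> ?m \<and> 0 < ?\<psi> ?m" using LeastI_ex[OF ex] .
    then have in_m: "?m \<in> {1..?m}" and "?\<psi> ?m \<noteq> 0" by auto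
    then show "\<not> (\<forall>l\<in>{1..?m}. ?\<psi> l = 0)" using bspec[OF _ in_m] by metis
    fix i assume "\<not> (\<forall>l\<in>{1..i}. ?\<psi> l = 0)"
    then obtain l where "1 \<le> l" "l \<le> i" "0 < ?\<psi> l" by auto
    then show "?m \<le> i" using Least_le[of "\<lambda>i. i \<ge> 1 \<and> 0 < ?\<psi> i" l] by simp
  qed
  show ?thesis unfolding first_nonzero_def orbit_level_def *
    by (rule if_cong[OF ex_iff _ refl], rule least) (simp only: ex_iff)
qed

lemma orbit_level_ge_1: "1 \<le> orbit_level \<omega> n"
proof (cases "\<exists>i. \<not> 5 ^ i dvd digit_value \<omega> i + n")
  case True
  then have "\<not> 5 ^ orbit_level \<omega> n dvd digit_value \<omega> (orbit_level \<omega> n) + n"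
    unfolding orbit_level_def using LeastI_ex[OF True] by simp
  then have "orbit_level \<omega> n \<noteq> 0" by (intro notI) simp
  then show ?thesis by simp
qed (simp add: orbit_level_def)

text \<open>An integer orbit reaches the zero sequence only if the digits are eventually all \<open>0\<close> or all
  \<open>4\<close>; here \<open>1\<close> serves as a digit different from both.\<close>

lemma orbit_level_iff:
  assumes \<omega>: "\<omega> \<in> digit_seqs" and ones: "infinite {k. \<omega> (Suc k) = 1}"
  shows "k < orbit_level \<omega> n \<longleftrightarrow> 5 ^ k dvd digit_value \<omega> k + n"
proof -
  have ex: "\<exists>i. \<not> 5 ^ i dvd digit_value \<omega> i + n"
  proof (rule ccontr)
    assume "\<not> ?thesis"
    then have dvd: "5 ^ i dvd digit_value \<omega> i + n" for i by simp
    \<comment> \<open>A position so large that \<open>\<bar>n\<bar> < 5 ^ i\<close>, with digit 1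
      next.\<close>
    obtain i where i: "nat \<bar>n\<bar> \<le> i" "\<omega> (Suc i) = 1" using ones unfolding infinite_nat_iff_unbounded_le by blast
    have "\<bar>n\<bar> \<le> int i" using i by simp
    also have "int i < 5 ^ i" using of_nat_less_two_power[of i, where 'a = int] power_mono[of "2::int" 5 i] by linarith
    finally have small: "\<bar>n\<bar> < 5 ^ i" .
    have cases: "digit_value \<omega> l = - n \<or> digit_value \<omega> l = 5 ^ l - n" if "5 ^ i \<le> (5::int) ^ l" for l
    proof -
      obtain q where q: "digit_value \<omega> l + n = 5 ^ l * q" using dvd[of l] by (elim dvdE)
      have "5 ^ l * q < 5 ^ l * 2" "5 ^ l * (-1) < 5 ^ l * q"
        using q digit_value_bounds[OF \<omega>, of l] small that by linarith+
      then have "q < 2" "-1 < q" by (simp_all only: mult_less_cancel_left_pos zero_less_power zero_less_numeral)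
      then have "q = 0 \<or> q = 1" by auto
      then show ?thesis using q by auto
    qed
    \<comment> \<open>Between positions i and i + 1 the possible values -n and
      \<open>5 ^ l - n\<close> differ by 0, 4, 5 or -1 times \<open>5 ^ i\<close>, never by
      \<open>5 ^ i\<close> itself.\<close>
    have "digit_value \<omega> (Suc i) = digit_value \<omega> i + 5 ^ i" using i by (simp add: digit_value_Suc)
    then show False using cases[of i] cases[of "Suc i"] by auto
  qed
  have mono: "5 ^ k dvd digit_value \<omega> k + n" if "5 ^ l dvd digit_value \<omega> l + n" "k \<le> l" for k l
    using that(2,1)
  proof (induction l rule: dec_induct)
    case (step l)
    have "5 ^ l dvd (digit_value \<omega> (Suc l) + n) - int (\<omega> (Suc l)) * 5 ^ l"
      using step.prems by (intro dvd_diff) (auto intro: dvd_trans[of _ "5 ^ Suc l"])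
    then show ?case using step.IH by (simp add: digit_value_Suc)
  qed simp
  show ?thesis
  proof
    assume "k < orbit_level \<omega> n"
    then show "5 ^ k dvd digit_value \<omega> k + n" using ex not_less_Least unfolding orbit_level_def by auto
  next
    assume k: "5 ^ k dvd digit_value \<omega> k + n"
    have "\<not> 5 ^ orbit_level \<omega> n dvd digit_value \<omega> (orbit_level \<omega> n) + n"
      unfolding orbit_level_def using LeastI_ex[OF ex] ex by simp
    then show "k < orbit_level \<omega> n" using mono[OF k] by (metis not_le)
  qed
qed

lemma five_adic_orbit_level:
  assumes "\<omega> \<in> digit_seqs" "infinite {k. \<omega> (Suc k) = 1}"
  shows "five_adic_levels (orbit_level \<omega>)"
  unfolding five_adic_levels_def orbit_level_iff[OF assms]
  by (intro allI exI[of _ "- digit_value \<omega> _"]) (simp add: add.commute)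

text \<open>The lines of level greater than k are the class of minus the digit sum modulo
  \<open>5 ^ k\<close>, or of plus the digit sum after reflection. Positivity makes
  \<open>5 ^ k - digit_value \<omega> k\<close> the least nonnegative representative.\<close>

lemma nearest_orbit_level:
  assumes \<omega>: "\<omega> \<in> digit_seqs" and ones: "infinite {k. \<omega> (Suc k) = 1}" and pos: "0 < digit_value \<omega> k"
  shows "int (nearest (orbit_level \<omega>) k) = 5 ^ k - digit_value \<omega> k"
    and "int (nearest (\<lambda>x. orbit_level \<omega> (- x)) k) = digit_value \<omega> k"
proof -
  have eq: "int (nearest c k) = x"
    if x: "0 \<le> x" "x < 5 ^ k" and c: "\<And>z. k < c z \<longleftrightarrow> 5 ^ k dvd z - x" for c x
  proof -
    have "nearest c k = nat x" unfolding nearest_def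
    proof (rule Least_equality)
      show "k < c (int (nat x))" using x by (simp add: c)
      fix n assume "k < c (int n)"
      then have dvd: "5 ^ k dvd int n - x" by (simp add: c)
      have "x \<le> int n"
      proof (rule ccontr)
        assume "\<not> x \<le> int n"
        moreover have "5 ^ k dvd x - int n" using dvd by (simp add: dvd_diff_commute)
        ultimately show False using zdvd_imp_le[of "5 ^ k" "x - int n"] x by simp
      qed
      then show "nat x \<le> n" by simp
    qed
    then show ?thesis using x by simp
  qed
  note bounds = digit_value_bounds[OF \<omega>, of k]
  show "int (nearest (orbit_level \<omega>) k) = 5 ^ k - digit_value \<omega> k"
  proof (rule eq)
    fix z
    have "z - (5 ^ k - digit_value \<omega> k) = digit_value \<omega> k + z - 5 ^ k" by simp
    then show "k < orbit_level \<omega> z \<longleftrightarrow> 5 ^ k dvd z - (5 ^ k - digit_value \<omega> k)"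
      unfolding orbit_level_iff[OF \<omega> ones] by (metis dvd_diff_left_iff dvd_refl)
  qed (use bounds pos in auto)
  show "int (nearest (\<lambda>x. orbit_level \<omega> (- x)) k) = digit_value \<omega> k"
  proof (rule eq)
    fix z
    show "k < orbit_level \<omega> (- z) \<longleftrightarrow> 5 ^ k dvd z - digit_value \<omega> k"
      unfolding orbit_level_iff[OF \<omega> ones] using dvd_diff_commute[of "5 ^ k" "digit_value \<omega> k" z] by simp
  qed (use bounds in auto)
qed

text \<open>On the positive side the nearest line stays when the new digit 4 absorbs the growth
  \<open>4 * 5 ^ k\<close> of the modulus; on the negative side, when the new digit adds
  nothing.\<close>

lemma nearest_orbit_level_switch:
  assumes \<omega>: "\<omega> \<in> digit_seqs" and ones: "infinite {k. \<omega> (Suc k) = 1}" and pos: "0 < digit_value \<omega> k"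
    and r: "r \<in> {1, -1}"
  shows "nearest (\<lambda>x. orbit_level \<omega> (r * x)) k = nearest (\<lambda>x. orbit_level \<omega> (r * x)) (Suc k)
    \<longleftrightarrow> \<omega> (Suc k) = (if r = 1 then 4 else 0)"
proof -
  have pos': "0 < digit_value \<omega> (Suc k)" using pos by (simp add: digit_value_Suc add_pos_nonneg)
  have "5 ^ k - digit_value \<omega> k = 5 ^ Suc k - digit_value \<omega> (Suc k) \<longleftrightarrow> int (\<omega> (Suc k)) * 5 ^ k = 4 * 5 ^ k"
    unfolding digit_value_Suc by auto
  also have "\<dots> \<longleftrightarrow> \<omega> (Suc k) = 4" by simp
  finally have plus: "5 ^ k - digit_value \<omega> k = 5 ^ Suc k - digit_value \<omega> (Suc k) \<longleftrightarrow> \<omega> (Suc k) = 4" .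
  have minus: "digit_value \<omega> k = digit_value \<omega> (Suc k) \<longleftrightarrow> \<omega> (Suc k) = 0"
    unfolding digit_value_Suc by simp
  from r consider "r = 1" | "r = -1" by auto
  then show ?thesis
  proof cases
    case 1
    then show ?thesis unfolding of_nat_eq_iff[where 'a = int and m = "nearest _ _", symmetric]
      using nearest_orbit_level(1)[OF \<omega> ones pos] nearest_orbit_level(1)[OF \<omega> ones pos'] plus by simp
  next
    case 2
    then show ?thesis unfolding of_nat_eq_iff[where 'a = int and m = "nearest _ _", symmetric]
      using nearest_orbit_level(2)[OF \<omega> ones pos] nearest_orbit_level(2)[OF \<omega> ones pos'] minus by simp
  qed
qed

text \<open>Digit 1 moves the nearest line on both sides. Digits 4 and 0 keep it on the positive and
  the negative side respectively, so pairing each with a 1 yields switches in all four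
  quadrants.\<close>

definition generic_digits :: "(nat \<Rightarrow> nat) \<Rightarrow> (nat \<Rightarrow> nat) \<Rightarrow> bool" where
  "generic_digits \<omega>1 \<omega>2 \<longleftrightarrow> infinite {k. \<omega>1 (Suc k) = 1} \<and>
    infinite {k. \<omega>1 (Suc k) = 0 \<and> \<omega>2 (Suc k) = 1} \<and> infinite {k. \<omega>1 (Suc k) = 4 \<and> \<omega>2 (Suc k) = 1}"

lemma generic_digits_ones:
  "generic_digits \<omega>1 \<omega>2 \<Longrightarrow> infinite {k. \<omega>1 (Suc k) = 1}"
  "generic_digits \<omega>1 \<omega>2 \<Longrightarrow> infinite {k. \<omega>2 (Suc k) = 1}"
  unfolding generic_digits_def using infinite_super[of "{k. \<omega>1 (Suc k) = 0 \<and> \<omega>2 (Suc k) = 1}" "{k. \<omega>2 (Suc k) = 1}"]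
  by auto

lemma infinite_level_switches:
  assumes \<omega>: "\<omega>1 \<in> digit_seqs" "\<omega>2 \<in> digit_seqs" and generic: "generic_digits \<omega>1 \<omega>2"
    and rs: "r \<in> {1, -1}" "s \<in> {1, -1}"
  shows "infinite (level_switches (\<lambda>x. orbit_level \<omega>2 (r * x)) (\<lambda>y. orbit_level \<omega>1 (s * y)))"
proof -
  note ones = generic_digits_ones[OF generic]
  have pos: "\<exists>K. \<forall>k\<ge>K. 0 < digit_value \<omega> k" if inf: "infinite {k. \<omega> (Suc k) = 1}" for \<omega> :: "nat \<Rightarrow> nat"
  proof -
    obtain i where i: "\<omega> (Suc i) = 1" using not_finite_existsD[OF inf] by blast
    have "0 < digit_value \<omega> k" if "Suc i \<le> k" for k
      unfolding digit_value_def by (rule sum_pos2[of _ i]) (use i that in auto)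
    then show ?thesis by blast
  qed
  obtain K1 where K1: "\<And>k. K1 \<le> k \<Longrightarrow> 0 < digit_value \<omega>1 k" using pos[OF ones(1)] by blast
  obtain K2 where K2: "\<And>k. K2 \<le> k \<Longrightarrow> 0 < digit_value \<omega>2 k" using pos[OF ones(2)] by blast
  \<comment> \<open>With this digit of \<omega>1 the nearest row stays, while the digit 1 of
    \<omega>2 moves the nearest column for either sign r.\<close>
  define d :: nat where "d = (if s = 1 then 4 else 0)"
  have "infinite {k. \<omega>1 (Suc k) = d \<and> \<omega>2 (Suc k) = 1}"
    using generic rs unfolding generic_digits_def d_def by auto
  then have "infinite ({k. \<omega>1 (Suc k) = d \<and> \<omega>2 (Suc k) = 1} - {..<max K1 K2})" by simp
  moreover have "{k. \<omega>1 (Suc k) = d \<and> \<omega>2 (Suc k) = 1} - {..<max K1 K2}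
    \<subseteq> level_switches (\<lambda>x. orbit_level \<omega>2 (r * x)) (\<lambda>y. orbit_level \<omega>1 (s * y))"
    using nearest_orbit_level_switch[OF \<omega>(1) ones(1) K1 rs(2)] nearest_orbit_level_switch[OF \<omega>(2) ones(2) K2 rs(1)]
    unfolding level_switches_def d_def by (auto simp: not_less split: if_splits)
  ultimately show ?thesis using infinite_super by blast
qed

subsection \<open>The random environment\<close>

lemma space_digit_measure: "space digit_measure = digit_seqs"
  by (simp add: digit_measure_def digit_seqs_def space_PiM space_uniform_count_measure)

lemma prob_space_digit: "prob_space (uniform_count_measure {0, 1, 2, 3, 4 :: nat})"
  by (rule prob_space_uniform_count_measure) auto

lemma prob_space_digit_measure: "prob_space digit_measure"
  unfolding digit_measure_def by (rule prob_space_PiM) (rule prob_space_digit)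

lemma measurable_digit [measurable]: "(\<lambda>\<omega>. \<omega> (Suc i)) \<in> digit_measure \<rightarrow>\<^sub>M count_space UNIV"
proof -
  have "(\<lambda>\<omega>. \<omega> (Suc i)) \<in> digit_measure \<rightarrow>\<^sub>M uniform_count_measure {0, 1, 2, 3, 4}"
    unfolding digit_measure_def by (rule measurable_component_singleton) simp
  moreover have "(\<lambda>x. x) \<in> uniform_count_measure {0, 1, 2, 3, 4 :: nat} \<rightarrow>\<^sub>M count_space UNIV"
    by (auto simp: measurable_def sets_uniform_count_measure space_uniform_count_measure)
  ultimately show ?thesis by (rule measurable_compose)
qed

lemma measurable_digit_value [measurable]: "(\<lambda>\<omega>. digit_value \<omega> i) \<in> digit_measure \<rightarrow>\<^sub>M count_space UNIV"
proof (induction i)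
  case 0 then show ?case by (simp add: digit_value_def)
next
  case (Suc i)
  have "(\<lambda>\<omega>. v + int (\<omega> (Suc i)) * 5 ^ i) \<in> digit_measure \<rightarrow>\<^sub>M count_space UNIV" for v
    by (rule measurable_compose[OF measurable_digit]) simp
  from measurable_compose_countable[OF this Suc] show ?case by (simp add: digit_value_Suc)
qed

lemma measurable_orbit_level [measurable]: "(\<lambda>\<omega>. orbit_level \<omega> n) \<in> digit_measure \<rightarrow>\<^sub>M count_space UNIV"
proof -
  have [measurable]: "Measurable.pred digit_measure (\<lambda>\<omega>. 5 ^ i dvd digit_value \<omega> i + n)" for i
    by (rule measurable_compose[OF measurable_digit_value]) simp
  show ?thesis unfolding orbit_level_def by measurable
qed

text \<open>Avoiding d at n given positions has probability \<open>(4 / 5) ^ n\<close>. The set A is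
  arbitrary so that, for fixed \<omega>1, it can be the set of positions where \<omega>1 has a
  prescribed digit.\<close>

lemma AE_digit_infinitely_often:
  assumes A: "infinite A" and d: "d \<in> {0, 1, 2, 3, 4}"
  shows "AE \<omega> in digit_measure. infinite {k \<in> A. \<omega> (Suc k) = d}"
proof -
  interpret prob_space digit_measure by (rule prob_space_digit_measure)
  let ?U = "uniform_count_measure {0, 1, 2, 3, 4 :: nat}"
  have null: "AE \<omega> in digit_measure. \<exists>k\<in>A. N \<le> k \<and> \<omega> (Suc k) = d" for N
  proof (rule AE_I')
    let ?E = "{\<omega> \<in> space digit_measure. \<not> (\<exists>k\<in>A. N \<le> k \<and> \<omega> (Suc k) = d)}"
    have meas: "?E \<in> sets digit_measure" by measurable
    have "measure digit_measure ?E \<le> (4 / 5) ^ n" for n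
    proof -
      have "infinite (A - {..<N})" using A by simp
      then obtain J where J: "finite J" "card J = n" "J \<subseteq> A - {..<N}"
        using infinite_arbitrarily_large by metis
      \<comment> \<open>The cylinder of sequences avoiding d on n positions of A beyond N.\<close>
      let ?C = "prod_emb {1..} (\<lambda>_. ?U) (Suc ` J) (Pi\<^sub>E (Suc ` J) (\<lambda>_. {0, 1, 2, 3, 4} - {d}))"
      have ne: "\<omega> (Suc k) \<noteq> d" if "\<omega> \<in> ?E" "k \<in> J" for \<omega> k
      proof -
        have "k \<in> A" "N \<le> k" using J(3) that(2) by auto
        then show ?thesis using that(1) by blast
      qed
      have sub: "?E \<subseteq> ?C"
      proof
        fix \<omega> assume E: "\<omega> \<in> ?E"
        then have "\<omega> \<in> {1..} \<rightarrow>\<^sub>E {0, 1, 2, 3, 4}" by (simp add: space_digit_measure digit_seqs_def)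
        moreover from this have "\<omega> (Suc k) \<in> {0, 1, 2, 3, 4}" for k by (rule PiE_mem) simp
        then have "\<omega> i \<in> {0, 1, 2, 3, 4} - {d}" if "i \<in> Suc ` J" for i
          using that ne[OF E] by (elim imageE) (metis DiffI singletonD)
        then have "restrict \<omega> (Suc ` J) \<in> Pi\<^sub>E (Suc ` J) (\<lambda>_. {0, 1, 2, 3, 4} - {d})"
          by (intro restrict_PiE_iff[THEN iffD2] ballI)
        ultimately show "\<omega> \<in> ?C" by (simp add: prod_emb_def space_uniform_count_measure)
      qed
      have C: "?C \<in> sets digit_measure" unfolding digit_measure_def
        by (intro sets_PiM_I) (use J in \<open>auto simp: sets_uniform_count_measure\<close>)
      have "emeasure digit_measure ?C = (\<Prod>i\<in>Suc ` J. emeasure ?U ({0, 1, 2, 3, 4} - {d}))"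
        unfolding digit_measure_def
        by (rule emeasure_PiM_emb) (use J prob_space_digit in \<open>auto simp: sets_uniform_count_measure\<close>)
      also have "emeasure ?U ({0, 1, 2, 3, 4} - {d}) = ennreal (4 / 5)"
        by (subst emeasure_uniform_count_measure) (use d in auto)
      finally have "emeasure digit_measure ?C = ennreal ((4 / 5) ^ n)"
        using J by (simp add: card_image ennreal_power)
      then have "measure digit_measure ?C = (4 / 5) ^ n" by (simp add: measure_def)
      then show ?thesis using finite_measure_mono[OF sub C] by simp
    qed
    moreover have "(\<lambda>n. (4 / 5 :: real) ^ n) \<longlonglongrightarrow> 0" by (rule LIMSEQ_realpow_zero) auto
    ultimately have "measure digit_measure ?E \<le> 0" by (intro LIMSEQ_le_const[of _ 0]) auto
    then have "emeasure digit_measure ?E = 0" by (simp add: emeasure_eq_measure measure_le_0_iff)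
    then show "?E \<in> null_sets digit_measure" using meas by (simp add: null_sets_def)
  qed auto
  have "AE \<omega> in digit_measure. \<forall>N. \<exists>k\<in>A. N \<le> k \<and> \<omega> (Suc k) = d"
    using null by (simp add: AE_all_countable)
  then show ?thesis by eventually_elim (auto simp: infinite_nat_iff_unbounded_le)
qed

lemma AE_generic_digits:
  "AE \<omega>1 in digit_measure. AE \<omega>2 in digit_measure. generic_digits \<omega>1 \<omega>2"
proof -
  have "AE \<omega> in digit_measure. infinite {k \<in> UNIV. \<omega> (Suc k) = d}" if "d \<in> {0, 1, 4}" for d
    by (rule AE_digit_infinitely_often) (use that in auto)
  from this[of 0] this[of 1] this[of 4]
  have "AE \<omega> in digit_measure. infinite {k. \<omega> (Suc k) = 0} \<and> infinite {k. \<omega> (Suc k) = 1} \<and> infinite {k. \<omega> (Suc k) = 4}"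
    by auto
  then show ?thesis
  proof eventually_elim
    case (elim \<omega>1)
    then have "AE \<omega>2 in digit_measure. infinite {k \<in> {k. \<omega>1 (Suc k) = 0}. \<omega>2 (Suc k) = 1}"
      "AE \<omega>2 in digit_measure. infinite {k \<in> {k. \<omega>1 (Suc k) = 4}. \<omega>2 (Suc k) = 1}"
      by (intro AE_digit_infinitely_often; simp)+
    then show ?case by eventually_elim (use elim in \<open>simp add: generic_digits_def\<close>)
  qed
qed

section \<open>Perturbations and measurability of the weights\<close>

definition perturbation_law :: "real \<Rightarrow> nat \<times> edge \<Rightarrow> real measure" where
  "perturbation_law \<alpha> = (\<lambda>(j, e). uniform_measure (restrict_space lborel {0..}) {0..\<alpha> ^ j * (1 - \<alpha>) / 1000})"

lemma perturbation_measure_eq: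
  "perturbation_measure \<alpha> = PiM ({1..} \<times> lattice_edges) (perturbation_law \<alpha>)"
  by (simp add: perturbation_measure_def perturbation_law_def)

lemma sets_perturbation_law: "sets (perturbation_law \<alpha> i) = sets nonneg_borel"
  by (cases i) (simp add: perturbation_law_def nonneg_borel_def sets_restrict_space)

lemma space_perturbation_law: "space (perturbation_law \<alpha> i) = {0..}"
  by (cases i) (simp add: perturbation_law_def space_restrict_space)

context
  fixes \<alpha> :: real
  assumes \<alpha>: "0 < \<alpha>" "\<alpha> < 1 / 5"
begin

lemma perturbation_law:
  shows prob_space_perturbation_law: "prob_space (perturbation_law \<alpha> (j, e))"
    and AE_perturbation_law: "AE x in perturbation_law \<alpha> (j, e). 0 \<le> x \<and> x \<le> \<alpha> ^ j * (1 - \<alpha>) / 1000"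
proof -
  let ?c = "\<alpha> ^ j * (1 - \<alpha>) / 1000"
  have c: "0 < ?c" using \<alpha> by simp
  have sets: "{0..?c} \<in> sets (restrict_space lborel {0..})"
    by (auto simp: sets_restrict_space image_iff intro!: bexI[of _ "{0..?c}"])
  have em: "emeasure (restrict_space lborel {0..}) {0..?c} = ennreal ?c"
    by (subst emeasure_restrict_space) (use c in auto)
  show "prob_space (perturbation_law \<alpha> (j, e))"
    unfolding perturbation_law_def prod.case
    by (rule prob_space_uniform_measure; simp only: em ennreal_eq_0_iff not_le c infinity_ennreal_def ennreal_neq_top not_False_eq_True)
  show "AE x in perturbation_law \<alpha> (j, e). 0 \<le> x \<and> x \<le> ?c"
    unfolding perturbation_law_def prod.case by (rule AE_uniform_measureI[OF sets]) auto
qed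

lemma prob_space_perturbation_measure: "prob_space (perturbation_measure \<alpha>)"
  unfolding perturbation_measure_eq by (rule prob_space_PiM) (use prob_space_perturbation_law in auto)

definition small_perturbation :: "(nat \<times> edge \<Rightarrow> real) \<Rightarrow> bool" where
  "small_perturbation X \<longleftrightarrow> (\<forall>j e. e \<in> lattice_edges \<longrightarrow>
     0 \<le> X (Suc j, e) \<and> X (Suc j, e) \<le> \<alpha> ^ Suc j * (1 - \<alpha>) / 1000)"

lemma AE_small_perturbation: "AE X in perturbation_measure \<alpha>. small_perturbation X"
proof -
  have "AE X in perturbation_measure \<alpha>. e \<in> lattice_edges \<longrightarrow>
     0 \<le> X (Suc j, e) \<and> X (Suc j, e) \<le> \<alpha> ^ Suc j * (1 - \<alpha>) / 1000" for j e
  proof (cases "e \<in> lattice_edges")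
    case True
    have "AE X in perturbation_measure \<alpha>. 0 \<le> X (Suc j, e) \<and> X (Suc j, e) \<le> \<alpha> ^ Suc j * (1 - \<alpha>) / 1000"
      unfolding perturbation_measure_eq
    proof (rule AE_PiM_component[where i = "(Suc j, e)" and P = "\<lambda>x. 0 \<le> x \<and> x \<le> \<alpha> ^ Suc j * (1 - \<alpha>) / 1000"])
      show "prob_space (perturbation_law \<alpha> i)" for i using prob_space_perturbation_law by (cases i) auto
      show "AE x in perturbation_law \<alpha> (Suc j, e). 0 \<le> x \<and> x \<le> \<alpha> ^ Suc j * (1 - \<alpha>) / 1000"
        by (rule AE_perturbation_law)
    qed (use True in simp)
    then show ?thesis by simp
  qed simp
  then show ?thesis unfolding small_perturbation_def by (simp only: AE_all_countable) blast
qed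

end

lemma measurable_edge_weight [measurable]:
  assumes "e \<in> lattice_edges"
  shows "(\<lambda>t. t e) \<in> config_space \<rightarrow>\<^sub>M borel"
proof -
  have "(\<lambda>t. t e) \<in> config_space \<rightarrow>\<^sub>M nonneg_borel"
    unfolding config_space_def by (rule measurable_component_singleton[OF assms])
  moreover have "(\<lambda>x. x) \<in> nonneg_borel \<rightarrow>\<^sub>M borel"
    unfolding nonneg_borel_def by (rule measurable_restrict_space1) simp
  ultimately show ?thesis by (rule measurable_compose)
qed

lemma measurable_perturbation:
  assumes "e \<in> lattice_edges" "1 \<le> j"
  shows "(\<lambda>X. X (j, e)) \<in> perturbation_measure \<alpha> \<rightarrow>\<^sub>M borel"
proof -
  have "(\<lambda>X. X (j, e)) \<in> perturbation_measure \<alpha> \<rightarrow>\<^sub>M perturbation_law \<alpha> (j, e)"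
    unfolding perturbation_measure_eq by (rule measurable_component_singleton) (use assms in simp)
  then have "(\<lambda>X. X (j, e)) \<in> perturbation_measure \<alpha> \<rightarrow>\<^sub>M nonneg_borel"
    by (simp cong: measurable_cong_sets add: sets_perturbation_law)
  moreover have "(\<lambda>x. x) \<in> nonneg_borel \<rightarrow>\<^sub>M borel"
    unfolding nonneg_borel_def by (rule measurable_restrict_space1) simp
  ultimately show ?thesis by (rule measurable_compose)
qed

abbreviation source_measure :: "real \<Rightarrow> ((nat \<Rightarrow> nat) \<times> (nat \<Rightarrow> nat) \<times> (nat \<times> edge \<Rightarrow> real)) measure" where
  "source_measure \<alpha> \<equiv> digit_measure \<Otimes>\<^sub>M (digit_measure \<Otimes>\<^sub>M perturbation_measure \<alpha>)"

lemma edge_level_eq: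
  assumes "\<omega>1 \<in> digit_seqs" "\<omega>2 \<in> digit_seqs"
  shows "edge_level \<omega>1 \<omega>2 e =
    (if snd e = fst e + \<e>1 then orbit_level \<omega>1 (snd (fst e)) else orbit_level \<omega>2 (fst (fst e)))"
  using assms by (cases e) (simp add: edge_level_def first_nonzero_pow)

text \<open>The level is a random index into X. Since it takes countably many values, measurability
  for each fixed index suffices.\<close>

lemma measurable_weight_config:
  assumes \<alpha>: "0 < \<alpha>"
  shows "weight_config \<alpha> \<in> source_measure \<alpha> \<rightarrow>\<^sub>M config_space"
proof -
  define L where "L e z = (if snd e = fst e + \<e>1 then orbit_level (fst z) (snd (fst e))
    else orbit_level (fst (snd z)) (fst (fst e)))"
    for e :: edge and z :: "(nat \<Rightarrow> nat) \<times> (nat \<Rightarrow> nat) \<times> (nat \<times> edge \<Rightarrow> real)"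
  have L_ge: "1 \<le> L e z" for e z using orbit_level_ge_1 by (simp add: L_def)
  have [measurable]: "L e \<in> source_measure \<alpha> \<rightarrow>\<^sub>M count_space UNIV" for e
    unfolding L_def by measurable
  have "(\<lambda>z. \<lambda>e\<in>lattice_edges. 1 + \<alpha> ^ L e z + snd (snd z) (L e z, e)) \<in> source_measure \<alpha> \<rightarrow>\<^sub>M config_space"
    unfolding config_space_def
  proof (rule measurable_restrict)
    fix e :: edge assume e: "e \<in> lattice_edges"
    \<comment> \<open>The index 0 lies outside the product, so a constant replaces X there; levels
      are at least 1, which makes the replacement invisible.\<close>
    have "(\<lambda>z. 1 + \<alpha> ^ k + (if k = 0 then 0 else snd (snd z) (k, e))) \<in> source_measure \<alpha> \<rightarrow>\<^sub>M borel" for k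
    proof (cases "k = 0")
      case False
      then have [measurable]: "(\<lambda>X. X (k, e)) \<in> perturbation_measure \<alpha> \<rightarrow>\<^sub>M borel"
        using measurable_perturbation[OF e] by simp
      show ?thesis using False by simp
    qed simp
    then have "(\<lambda>z. 1 + \<alpha> ^ L e z + (if L e z = 0 then 0 else snd (snd z) (L e z, e))) \<in> source_measure \<alpha> \<rightarrow>\<^sub>M borel"
      by (rule measurable_compose_countable) measurable
    moreover have "L e z \<noteq> 0" for z using L_ge[of e z] by simp
    ultimately have "(\<lambda>z. 1 + \<alpha> ^ L e z + snd (snd z) (L e z, e)) \<in> source_measure \<alpha> \<rightarrow>\<^sub>M borel" by simp
    then show "(\<lambda>z. 1 + \<alpha> ^ L e z + snd (snd z) (L e z, e)) \<in> source_measure \<alpha> \<rightarrow>\<^sub>M nonneg_borel"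
      unfolding nonneg_borel_def
    proof (rule measurable_restrict_space2[rotated], intro funcsetI)
      fix z assume z: "z \<in> space (source_measure \<alpha>)"
      show "1 + \<alpha> ^ L e z + snd (snd z) (L e z, e) \<in> {0..}"
      proof -
        have "snd (snd z) \<in> space (perturbation_measure \<alpha>)" using z by (auto simp: space_pair_measure)
        then have "snd (snd z) (L e z, e) \<in> space (perturbation_law \<alpha> (L e z, e))"
          unfolding perturbation_measure_eq space_PiM by (rule PiE_mem) (use L_ge e in simp)
        then show ?thesis using \<alpha> by (simp add: space_perturbation_law)
      qed
    qed
  qed
  then show ?thesis
  proof (rule measurable_cong[THEN iffD1, rotated])
    fix z assume "z \<in> space (source_measure \<alpha>)"
    then show "(\<lambda>e\<in>lattice_edges. 1 + \<alpha> ^ L e z + snd (snd z) (L e z, e)) = weight_config \<alpha> z"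
      by (cases z) (auto simp: weight_config_def space_pair_measure space_digit_measure L_def edge_level_eq fun_eq_iff)
  qed
qed

section \<open>Recovering the levels from the weights\<close>

text \<open>The weights of level k lie between \<open>1 + \<alpha> ^ k\<close> and
  \<open>max_cost \<alpha> k\<close>. These intervals are disjoint and decrease, so the level is the
  first k for which the next interval lies below the weight.\<close>

definition weight_level :: "real \<Rightarrow> (edge \<Rightarrow> real) \<Rightarrow> edge \<Rightarrow> nat" where
  "weight_level \<alpha> t e = (LEAST k. max_cost \<alpha> (Suc k) < t e)"

text \<open>The levels are recovered from the weights, so that the event is measurable in the space of
  configurations.\<close>

definition hierarchical_config :: "real \<Rightarrow> (edge \<Rightarrow> real) \<Rightarrow> bool" where
  "hierarchical_config \<alpha> t \<longleftrightarrow>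
    hierarchy \<alpha> (\<lambda>x. weight_level \<alpha> t ((x, 0), (x, 1))) (\<lambda>y. weight_level \<alpha> t ((0, y), (1, y))) t \<and>
    (\<forall>r\<in>{1, -1}. \<forall>s\<in>{1, -1}. infinite (level_switches
      (\<lambda>x. weight_level \<alpha> t ((r * x, 0), (r * x, 1))) (\<lambda>y. weight_level \<alpha> t ((0, s * y), (1, s * y)))))"

lemma lattice_edges_mem:
  "((x, y), (x, y + 1)) \<in> lattice_edges" "((x, y), (x + 1, y)) \<in> lattice_edges"
  "((x, 0), (x, 1)) \<in> lattice_edges" "((0, y), (1, y)) \<in> lattice_edges"
  by (auto simp: lattice_edges_def \<e>1_def \<e>2_def image_iff)

lemma measurable_weight_level [measurable]:
  assumes "e \<in> lattice_edges"
  shows "(\<lambda>t. weight_level \<alpha> t e) \<in> config_space \<rightarrow>\<^sub>M count_space UNIV"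
proof -
  note [measurable] = measurable_edge_weight[OF assms]
  show ?thesis unfolding weight_level_def by measurable
qed

lemma measurable_hierarchical_config [measurable]: "Measurable.pred config_space (hierarchical_config \<alpha>)"
proof -
  note [measurable] = measurable_weight_level[OF lattice_edges_mem(3)] measurable_weight_level[OF lattice_edges_mem(4)]
    measurable_edge_weight[OF lattice_edges_mem(1)] measurable_edge_weight[OF lattice_edges_mem(2)]
  have [measurable]: "(\<lambda>t. \<alpha> ^ f t) \<in> config_space \<rightarrow>\<^sub>M borel"
    if "f \<in> config_space \<rightarrow>\<^sub>M count_space UNIV" for f
    by (rule measurable_compose[OF that]) simp
  \<comment> \<open>After unfolding, all quantifiers range over countable types.\<close>
  show ?thesis
    unfolding hierarchical_config_def hierarchy_def five_adic_levels_def max_cost_def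
      level_switches_def nearest_def infinite_nat_iff_unbounded_le mem_Collect_eq ball_simps
    by measurable
qed

lemma hierarchical_config_num_rays:
  assumes "hierarchical_config \<alpha> t"
  shows "num_distinct_rays (origin_rays t) = 4"
  using assms unfolding hierarchical_config_def by (intro hierarchy.num_distinct_rays_eq_4) auto

lemma weight_level_eqI:
  assumes \<alpha>: "0 < \<alpha>" "\<alpha> < 1 / 5" and t: "1 + \<alpha> ^ k \<le> t e" "t e \<le> max_cost \<alpha> k"
  shows "weight_level \<alpha> t e = k"
  unfolding weight_level_def
proof (rule Least_equality)
  have "0 < \<alpha> ^ k" using \<alpha> by simp
  then have "1001 / 1000 * (\<alpha> * \<alpha> ^ k) < \<alpha> ^ k" using \<alpha> by simp
  then show "max_cost \<alpha> (Suc k) < t e" using t unfolding max_cost_def by simp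
  fix l assume l: "max_cost \<alpha> (Suc l) < t e"
  show "k \<le> l"
  proof (rule ccontr)
    assume "\<not> k \<le> l"
    then have "\<alpha> ^ k \<le> \<alpha> ^ Suc l" using \<alpha> by (intro power_decreasing) auto
    then show False using l t unfolding max_cost_def by simp
  qed
qed

lemma hierarchical_weight_config:
  assumes \<alpha>: "0 < \<alpha>" "\<alpha> < 1 / 5"
    and \<omega>: "\<omega>1 \<in> digit_seqs" "\<omega>2 \<in> digit_seqs" "generic_digits \<omega>1 \<omega>2" and X: "small_perturbation \<alpha> X"
  shows "hierarchical_config \<alpha> (weight_config \<alpha> (\<omega>1, \<omega>2, X))"
proof -
  let ?t = "weight_config \<alpha> (\<omega>1, \<omega>2, X)"
  have bounds: "1 + \<alpha> ^ k \<le> ?t e \<and> ?t e \<le> max_cost \<alpha> k"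
    if "e \<in> lattice_edges" "edge_level \<omega>1 \<omega>2 e = k" "1 \<le> k" for e k
  proof -
    have t: "?t e = 1 + \<alpha> ^ k + X (k, e)" using that by (simp add: weight_config_def)
    have "0 \<le> X (k, e)" "X (k, e) \<le> \<alpha> ^ k * (1 - \<alpha>) / 1000"
      using X that(1,3) unfolding small_perturbation_def[OF \<alpha>] by (metis Suc_pred' One_nat_def Suc_le_lessD)+
    moreover have "\<alpha> ^ k * (1 - \<alpha>) \<le> \<alpha> ^ k * 1" using \<alpha> by (intro mult_left_mono) auto
    ultimately show ?thesis unfolding t max_cost_def by simp
  qed
  have vertical: "1 + \<alpha> ^ orbit_level \<omega>2 x \<le> ?t ((x, y), (x, y + 1))
      \<and> ?t ((x, y), (x, y + 1)) \<le> max_cost \<alpha> (orbit_level \<omega>2 x)" for x y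
    by (rule bounds) (use \<omega> orbit_level_ge_1 in \<open>auto simp: lattice_edges_mem edge_level_eq \<e>1_def\<close>)
  have horizontal: "1 + \<alpha> ^ orbit_level \<omega>1 y \<le> ?t ((x, y), (x + 1, y))
      \<and> ?t ((x, y), (x + 1, y)) \<le> max_cost \<alpha> (orbit_level \<omega>1 y)" for x y
    by (rule bounds) (use \<omega> orbit_level_ge_1 in \<open>auto simp: lattice_edges_mem edge_level_eq \<e>1_def\<close>)
  have col: "weight_level \<alpha> ?t ((x, 0), (x, 1)) = orbit_level \<omega>2 x" for x
    using vertical[of x 0] by (intro weight_level_eqI \<alpha>) auto
  have row: "weight_level \<alpha> ?t ((0, y), (1, y)) = orbit_level \<omega>1 y" for y
    using horizontal[of y 0] by (intro weight_level_eqI \<alpha>) auto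
  note ones = generic_digits_ones[OF \<omega>(3)]
  have "hierarchy \<alpha> (orbit_level \<omega>2) (orbit_level \<omega>1) ?t"
    using \<alpha> five_adic_orbit_level[OF \<omega>(1) ones(1)] five_adic_orbit_level[OF \<omega>(2) ones(2)] vertical horizontal
    unfolding hierarchy_def by blast
  then show ?thesis
    unfolding hierarchical_config_def col row using infinite_level_switches[OF \<omega>] by blast
qed

text \<open>The three sources are fixed in turn, as the exceptional set of \<omega>2 depends on
  \<omega>1; measurability of the event allows the iterated statements to be combined.\<close>

lemma AE_hierarchical_config:
  assumes \<alpha>: "0 < \<alpha>" "\<alpha> < 1 / 5"
  shows "AE z in source_measure \<alpha>. hierarchical_config \<alpha> (weight_config \<alpha> z)"
proof -
  interpret D: prob_space digit_measure by (rule prob_space_digit_measure)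
  interpret P: prob_space "perturbation_measure \<alpha>" by (rule prob_space_perturbation_measure[OF \<alpha>])
  interpret A: pair_sigma_finite digit_measure "perturbation_measure \<alpha>" ..
  interpret DP: prob_space "digit_measure \<Otimes>\<^sub>M perturbation_measure \<alpha>"
    by (rule prob_space_pair) unfold_locales
  interpret B: pair_sigma_finite digit_measure "digit_measure \<Otimes>\<^sub>M perturbation_measure \<alpha>" ..
  note pred = measurable_compose[OF measurable_weight_config[OF \<alpha>(1)] measurable_hierarchical_config[of \<alpha>]]
  have inner: "AE y in digit_measure \<Otimes>\<^sub>M perturbation_measure \<alpha>. hierarchical_config \<alpha> (weight_config \<alpha> (\<omega>1, y))"
    if \<omega>1: "\<omega>1 \<in> space digit_measure" and generic: "AE \<omega>2 in digit_measure. generic_digits \<omega>1 \<omega>2" for \<omega>1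
  proof (rule A.AE_pair_measure)
    show "{y \<in> space (digit_measure \<Otimes>\<^sub>M perturbation_measure \<alpha>). hierarchical_config \<alpha> (weight_config \<alpha> (\<omega>1, y))}
      \<in> sets (digit_measure \<Otimes>\<^sub>M perturbation_measure \<alpha>)"
      using measurable_compose[OF measurable_Pair1'[OF \<omega>1] pred] by (simp only: pred_def)
    show "AE \<omega>2 in digit_measure. AE X in perturbation_measure \<alpha>.
        hierarchical_config \<alpha> (weight_config \<alpha> (\<omega>1, \<omega>2, X))"
      using generic AE_space
    proof eventually_elim
      case (elim \<omega>2)
      show ?case using AE_small_perturbation[OF \<alpha>]
      proof eventually_elim
        case (elim X)
        show ?case
          by (rule hierarchical_weight_config[OF \<alpha> _ _ _ elim])
            (use \<open>generic_digits \<omega>1 \<omega>2\<close> \<open>\<omega>2 \<in> space digit_measure\<close> \<omega>1 in \<open>simp_all add: space_digit_measure\<close>)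
      qed
    qed
  qed
  show ?thesis
  proof (rule B.AE_pair_measure)
    show "{z \<in> space (source_measure \<alpha>). hierarchical_config \<alpha> (weight_config \<alpha> z)} \<in> sets (source_measure \<alpha>)"
      using pred by (simp only: pred_def)
    show "AE \<omega>1 in digit_measure. AE y in digit_measure \<Otimes>\<^sub>M perturbation_measure \<alpha>.
        hierarchical_config \<alpha> (weight_config \<alpha> (\<omega>1, y))"
      using AE_generic_digits AE_space by eventually_elim (rule inner)
  qed
qed

theorem theorem1:
  fixes \<alpha> :: real
  assumes "0 < \<alpha>" and "\<alpha> < 0.2"
  shows "prob_space (fpp_measure \<alpha>)
    \<and> sets (fpp_measure \<alpha>) = sets config_space
    \<and> (AE t in fpp_measure \<alpha>. num_distinct_rays (origin_rays t) = 4)"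
proof -
  have \<alpha>: "0 < \<alpha>" "\<alpha> < 1 / 5" using assms by auto
  interpret S: prob_space "source_measure \<alpha>"
    by (intro prob_space_pair prob_space_digit_measure prob_space_perturbation_measure[OF \<alpha>])
  have "prob_space (fpp_measure \<alpha>)"
    unfolding fpp_measure_def by (rule S.prob_space_distr[OF measurable_weight_config[OF \<alpha>(1)]])
  moreover have "AE t in fpp_measure \<alpha>. hierarchical_config \<alpha> t"
    unfolding fpp_measure_def
    by (subst AE_distr_iff[OF measurable_weight_config[OF \<alpha>(1)]]) (use AE_hierarchical_config[OF \<alpha>] in measurable)
  then have "AE t in fpp_measure \<alpha>. num_distinct_rays (origin_rays t) = 4"
    by eventually_elim (rule hierarchical_config_num_rays)
  ultimately show ?thesis by (simp add: fpp_measure_def)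
qed

end
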